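(* Let $T$ be a finite tree of order at least $3$. Then $T$ is $2$-critical with $\mathrm{sd}(T)=2$ if and only if $T$ is isomorphic to the path $P_{3k+2}$ for some integer $k\ge 1$.
   Context: All graphs are finite and simple; $P_n$ is the path on $n$ vertices. A set $D\subseteq V(G)$ is dominating if every vertex of $V(G)\setminus D$ has a neighbour in $D$; $\gamma(G)$ is the minimum cardinality of a dominating set of $G$. For $F\subseteq E(G)$, $G_F$ denotes the graph obtained from $G$ by subdividing each edge of $F$ exactly once (each edge $uv\in F$ is replaced by a path $u,w,v$ with a new vertex $w$). For an integer $q\ge 1$, a connected graph $G$ of order at least $3$ is called $q$-critical ($\gamma$-$q$-critical) if $\gamma(G_F)>\gamma(G)$ for every $F\subseteq E(G)$ with $|F|=q$, and there is a set $F'\subseteq E(G)$ with $|F'|=q-1$ such that $\gamma(G_{F'})=\gamma(G)$. The domination subdivision number $\mathrm{sd}(G)$ is the minimum cardinality of a set $F\subseteq E(G)$ such that $\gamma(G_F)>\gamma(G)$. *)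

theory Defs
  imports Main
begin

record 'a sgraph =
  vertices :: "'a set"
  edges :: "'a set set"

definition simple_graph :: "'a sgraph \<Rightarrow> bool" where
  "simple_graph G \<longleftrightarrow>
     finite (vertices G) \<and> (\<forall>e\<in>edges G. e \<subseteq> vertices G \<and> card e = 2)"

definition adj :: "'a sgraph \<Rightarrow> 'a \<Rightarrow> 'a \<Rightarrow> bool" where
  "adj G u v \<longleftrightarrow> {u, v} \<in> edges G"

definition connected_graph :: "'a sgraph \<Rightarrow> bool" where
  "connected_graph G \<longleftrightarrow>
     vertices G \<noteq> {} \<and> (\<forall>u\<in>vertices G. \<forall>v\<in>vertices G. (adj G)\<^sup>*\<^sup>* u v)"

definition cycle :: "'a sgraph \<Rightarrow> 'a list \<Rightarrow> bool" where
  "cycle G vs \<longleftrightarrow>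
     3 \<le> length vs \<and> distinct vs \<and> successively (adj G) vs \<and> adj G (last vs) (hd vs)"

definition tree :: "'a sgraph \<Rightarrow> bool" where
  "tree G \<longleftrightarrow> simple_graph G \<and> connected_graph G \<and> (\<nexists>vs. cycle G vs)"

definition graph_iso :: "'a sgraph \<Rightarrow> 'b sgraph \<Rightarrow> bool" where
  "graph_iso G H \<longleftrightarrow>
     (\<exists>f. bij_betw f (vertices G) (vertices H) \<and>
          (\<forall>u\<in>vertices G. \<forall>v\<in>vertices G. adj G u v \<longleftrightarrow> adj H (f u) (f v)))"

definition path_graph :: "nat \<Rightarrow> nat sgraph" where
  "path_graph n = \<lparr>vertices = {..<n}, edges = {{i, Suc i} | i. Suc i < n}\<rparr>"

definition dominating :: "'a sgraph \<Rightarrow> 'a set \<Rightarrow> bool" where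
  "dominating G D \<longleftrightarrow>
     D \<subseteq> vertices G \<and> (\<forall>v\<in>vertices G - D. \<exists>u\<in>D. adj G u v)"

text \<open>For a finite graph the minimum ranges over a finite set, nonempty because the set of
  all vertices is dominating.\<close>

definition domination_number :: "'a sgraph \<Rightarrow> nat" where
  "domination_number G = Min (card ` {D. dominating G D})"

text \<open>The graph $G_F$. An original vertex \<open>v\<close> becomes \<open>Inl v\<close>; the new vertex placed on an
  edge \<open>e \<in> F\<close> is \<open>Inr e\<close>, adjacent exactly to the two endpoints of \<open>e\<close>.\<close>

definition subdivide :: "'a sgraph \<Rightarrow> 'a set set \<Rightarrow> ('a + 'a set) sgraph" where
  "subdivide G F =
     \<lparr>vertices = Inl ` vertices G \<union> Inr ` F,
      edges = {Inl ` e | e. e \<in> edges G - F} \<union> {{Inl u, Inr e} | u e. e \<in> F \<and> u \<in> e}\<rparr>"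

definition critical :: "nat \<Rightarrow> 'a sgraph \<Rightarrow> bool" where
  "critical q G \<longleftrightarrow>
     1 \<le> q \<and> simple_graph G \<and> connected_graph G \<and> 3 \<le> card (vertices G) \<and>
     (\<forall>F. F \<subseteq> edges G \<and> card F = q \<longrightarrow>
        domination_number (subdivide G F) > domination_number G) \<and>
     (\<exists>F'. F' \<subseteq> edges G \<and> card F' = q - 1 \<and>
        domination_number (subdivide G F') = domination_number G)"

text \<open>\<open>Inf\<close> on natural numbers is the minimum of a nonempty set, and 0 on the empty one. The
  value 0 arises only if no set of edges raises the domination number: for \<open>F = {}\<close> the
  number is unchanged, so every set that raises it is nonempty.\<close>

definition domination_subdivision_number :: "'a sgraph \<Rightarrow> nat" where
  "domination_subdivision_number G =
     Inf (card ` {F. F \<subseteq> edges G \<and> domination_number (subdivide G F) > domination_number G})"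

end

theory Submission
  imports Defs
begin

text \<open>
  Together the two conditions say that subdividing any single edge leaves the domination number
  unchanged, while subdividing any two edges raises it; call such trees tight. In a tight tree
  the end \<open>a, s, t, p\<close> of a longest path is rigid: two leaves at \<open>s\<close> would make the subdivision
  of one of their edges costly, and a leaf or a second pendant path of length two at \<open>t\<close> would
  give a pair of edges that can be subdivided for free. So \<open>a, s, t\<close> have degrees 1, 2, 2, and
  deleting them lowers the domination number by exactly one, whichever edges of the rest are
  subdivided. The rest is therefore tight, hence by induction a path with \<open>3k + 2\<close> vertices.
  If \<open>p\<close> were an inner vertex of it, then, depending on its position modulo 3, either subdividing
  \<open>st\<close> together with an edge at \<open>p\<close> would be free, or subdividing \<open>tp\<close> would already be costly.
\<close>

text \<open>The residue 2 comes from counting. In a path, as in each of its subdivisions, a vertex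
  dominates at most three vertices, itself included, so \<open>n\<close> chosen vertices cope with
  at most \<open>3 * n\<close>. For \<open>3 * k + 2\<close> vertices the \<open>k + 1\<close>
  chosen ones leave room for exactly one more vertex: one subdivision fits, two do not. The
  induction also needs to know which vertices of such a path can lie in a minimum dominating set.
  Count positions from 0. Those congruent to 0 can, even when an edge before them is subdivided;
  those congruent to 2 cannot; those congruent to 1 become congruent to 0 when the path is read
  backwards. This decides where \<open>a, s, t\<close> can be attached: if \<open>p\<close> is
  chosen anyway, \<open>t\<close> needs no help from \<open>s\<close>, and \<open>s\<close> can
  serve the new vertex on \<open>st\<close>; if \<open>p\<close> is in no minimum dominating set,
  the new vertex on \<open>tp\<close> costs one more. Only a position without an edge before it, an
  end of the path, escapes.\<close>

text \<open>\<open>A\<close> and \<open>X\<close> are the original and the new vertices of a dominating set of \<open>G\<^sub>F\<close>; this keeps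
  the vertex type of \<open>G\<close> when edges are subdivided.\<close>

definition dset :: "'a sgraph \<Rightarrow> 'a set set \<Rightarrow> 'a set \<Rightarrow> 'a set set \<Rightarrow> bool" where
  "dset G F A X \<longleftrightarrow> A \<subseteq> vertices G \<and> X \<subseteq> F \<and>
     (\<forall>v\<in>vertices G - A. (\<exists>u\<in>A. {u, v} \<in> edges G - F) \<or> (\<exists>e\<in>X. v \<in> e)) \<and>
     (\<forall>e\<in>F - X. e \<inter> A \<noteq> {})"

text \<open>A bound in place of a minimum: upper bounds are shown by exhibiting sets, lower bounds
  by taking sets apart. Since \<open>card\<close> is 0 on infinite sets, it is meaningful for finite
  graphs only.\<close>

definition dom_le :: "'a sgraph \<Rightarrow> 'a set set \<Rightarrow> nat \<Rightarrow> bool" where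
  "dom_le G F n \<longleftrightarrow> (\<exists>A X. dset G F A X \<and> card A + card X \<le> n)"

lemma dset_dominated:
  "dset G F A X \<Longrightarrow> v \<in> vertices G \<Longrightarrow> v \<notin> A \<Longrightarrow>
    (\<exists>u\<in>A. {u, v} \<in> edges G - F) \<or> (\<exists>e\<in>X. v \<in> e)"
  by (simp add: dset_def)

lemma dset_touched: "dset G F A X \<Longrightarrow> e \<in> F \<Longrightarrow> e \<notin> X \<Longrightarrow> \<exists>u\<in>A. u \<in> e"
proof -
  assume "dset G F A X" "e \<in> F" "e \<notin> X"
  then have "e \<inter> A \<noteq> {}" by (simp add: dset_def)
  then show ?thesis by blast
qed

lemma dom_leI: "dset G F A X \<Longrightarrow> card A + card X \<le> n \<Longrightarrow> dom_le G F n"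
  unfolding dom_le_def by blast

lemma dom_leE:
  assumes "dom_le G F n"
  obtains A X where "dset G F A X" "card A + card X \<le> n"
  using assms unfolding dom_le_def by blast

section \<open>Dominating sets of subdivided graphs\<close>

lemma domination_number_le_iff:
  assumes "finite (vertices G)"
  shows "domination_number G \<le> n \<longleftrightarrow> (\<exists>D. dominating G D \<and> card D \<le> n)"
proof -
  have "{D. dominating G D} \<subseteq> Pow (vertices G)"
    by (auto simp: dominating_def)
  then have "finite {D. dominating G D}"
    using assms by (meson finite_Pow_iff finite_subset)
  moreover have "dominating G (vertices G)"
    by (auto simp: dominating_def)
  ultimately show ?thesis
    unfolding domination_number_def by (subst Min_le_iff) auto
qed

lemma adj_subdivide:
  "adj (subdivide G F) (Inl u) (Inl v) \<longleftrightarrow> {u, v} \<in> edges G - F"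
  "adj (subdivide G F) (Inl u) (Inr e) \<longleftrightarrow> e \<in> F \<and> u \<in> e"
  "adj (subdivide G F) (Inr e) (Inl u) \<longleftrightarrow> e \<in> F \<and> u \<in> e"
  "\<not> adj (subdivide G F) (Inr e) (Inr f)"
proof -
  have *: "{Inl u, Inl v} = Inl ` e \<longleftrightarrow> {u, v} = e" for u v :: 'a and e
    using inj_image_eq_iff[OF inj_Inl, of "{u, v}" e] by simp
  show "adj (subdivide G F) (Inl u) (Inl v) \<longleftrightarrow> {u, v} \<in> edges G - F"
    by (auto simp: adj_def subdivide_def * doubleton_eq_iff)
  show "adj (subdivide G F) (Inl u) (Inr e) \<longleftrightarrow> e \<in> F \<and> u \<in> e"
    by (auto simp: adj_def subdivide_def doubleton_eq_iff)
  show "adj (subdivide G F) (Inr e) (Inl u) \<longleftrightarrow> e \<in> F \<and> u \<in> e"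
    by (auto simp: adj_def subdivide_def doubleton_eq_iff)
  show "\<not> adj (subdivide G F) (Inr e) (Inr f)"
    by (auto simp: adj_def subdivide_def doubleton_eq_iff)
qed

lemma dominating_subdivide:
  "dominating (subdivide G F) (A <+> X) \<longleftrightarrow> dset G F A X"
proof -
  have V: "vertices (subdivide G F) = vertices G <+> F"
    by (auto simp: subdivide_def)
  have I: "(\<exists>u\<in>A <+> X. adj (subdivide G F) u (Inl v)) \<longleftrightarrow>
      (\<exists>u\<in>A. {u, v} \<in> edges G - F) \<or> (\<exists>e\<in>X. v \<in> e)" if "X \<subseteq> F" for v
    using that by (auto simp: adj_subdivide Plus_def bex_Un)
  have J: "(\<exists>u\<in>A <+> X. adj (subdivide G F) u (Inr e)) \<longleftrightarrow> e \<inter> A \<noteq> {}" if "e \<in> F" for e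
    using that by (auto simp: adj_subdivide Plus_def bex_Un)
  have sub: "A <+> X \<subseteq> vertices G <+> F \<longleftrightarrow> A \<subseteq> vertices G \<and> X \<subseteq> F"
    by auto
  have all: "(\<forall>v\<in>(vertices G <+> F) - (A <+> X). P v) \<longleftrightarrow>
      (\<forall>v\<in>vertices G - A. P (Inl v)) \<and> (\<forall>e\<in>F - X. P (Inr e))" for P :: "'a + 'a set \<Rightarrow> bool"
    by auto
  show ?thesis
    unfolding dominating_def dset_def V sub all using I J by (cases "X \<subseteq> F") simp_all
qed

lemma domination_number_subdivide_le_iff:
  assumes "simple_graph G" "F \<subseteq> edges G"
  shows "domination_number (subdivide G F) \<le> n \<longleftrightarrow> dom_le G F n"
proof -
  have fV: "finite (vertices G)" using assms by (simp add: simple_graph_def)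
  have "edges G \<subseteq> Pow (vertices G)" using assms by (auto simp: simple_graph_def)
  then have fF: "finite F" using assms fV by (meson finite_Pow_iff finite_subset)
  have fin: "finite (vertices (subdivide G F))"
    using fV fF by (simp add: subdivide_def)
  have card: "card (A <+> X) = card A + card X" if "dset G F A X" for A X
    using that finite_subset[OF _ fV] finite_subset[OF _ fF] by (simp add: dset_def card_Plus)
  \<comment> \<open>Every subset of the sum type splits in this way, so the pairs \<open>A\<close>,
    \<open>X\<close> miss no dominating set.\<close>
  have D: "D = (Inl -` D) <+> (Inr -` D)" for D :: "('a + 'a set) set"
  proof (rule set_eqI)
    show "x \<in> D \<longleftrightarrow> x \<in> (Inl -` D) <+> (Inr -` D)" for x
      by (cases x) auto
  qed
  have "(\<exists>D. dominating (subdivide G F) D \<and> card D \<le> n) \<longleftrightarrow> dom_le G F n"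
  proof
    assume "\<exists>D. dominating (subdivide G F) D \<and> card D \<le> n"
    then obtain A X where "dominating (subdivide G F) (A <+> X)" "card (A <+> X) \<le> n"
      using D by metis
    then show "dom_le G F n"
      by (auto simp: dominating_subdivide card intro: dom_leI)
  next
    assume "dom_le G F n"
    then obtain A X where AX: "dset G F A X" "card A + card X \<le> n"
      by (rule dom_leE)
    show "\<exists>D. dominating (subdivide G F) D \<and> card D \<le> n"
      by (rule exI[of _ "A <+> X"]) (use AX in \<open>simp add: dominating_subdivide card\<close>)
  qed
  then show ?thesis using domination_number_le_iff[OF fin] by blast
qed

lemma domination_number_le_iff_dom_le:
  assumes "simple_graph G"
  shows "domination_number G \<le> n \<longleftrightarrow> dom_le G {} n"
proof -
  have fin: "finite (vertices G)" using assms by (simp add: simple_graph_def)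
  have "dset G {} A X \<longleftrightarrow> dominating G A \<and> X = {}" for A X
    by (auto simp: dset_def dominating_def adj_def)
  then show ?thesis
    unfolding domination_number_le_iff[OF fin] dom_le_def by auto
qed

lemma finite_edges:
  assumes "simple_graph G"
  shows "finite (edges G)"
proof (rule finite_subset)
  show "edges G \<subseteq> Pow (vertices G)" "finite (Pow (vertices G))"
    using assms by (auto simp: simple_graph_def)
qed

section \<open>Tight graphs and 2-criticality\<close>

text \<open>The first two clauses make \<open>n\<close> the domination number of a finite graph. It
  is an argument so that its drop by one can be followed when a pendant path is removed.\<close>

definition tight :: "'a sgraph \<Rightarrow> nat \<Rightarrow> bool" where
  "tight G n \<longleftrightarrow> dom_le G {} n \<and> (\<forall>m<n. \<not> dom_le G {} m) \<and> (\<forall>e\<in>edges G. dom_le G {e} n) \<and>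
     (\<forall>e\<in>edges G. \<forall>f\<in>edges G. e \<noteq> f \<longrightarrow> \<not> dom_le G {e, f} n)"

lemma tight_dom_le: "tight G n \<Longrightarrow> dom_le G {} n"
  and tight_dom_le_edge: "tight G n \<Longrightarrow> e \<in> edges G \<Longrightarrow> dom_le G {e} n"
  and tight_not_dom_le_less: "tight G n \<Longrightarrow> m < n \<Longrightarrow> \<not> dom_le G {} m"
  and tight_not_dom_le_pair:
    "tight G n \<Longrightarrow> e \<in> edges G \<Longrightarrow> f \<in> edges G \<Longrightarrow> e \<noteq> f \<Longrightarrow> \<not> dom_le G {e, f} n"
  by (simp_all add: tight_def)

text \<open>Criticality speaks about pairs of edges, the subdivision number about single edges. The
  edges \<open>e0\<close> and \<open>f0\<close> guarantee that some set of edges raises the number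
  and that a single edge is available as \<open>F'\<close>.\<close>

lemma critical_sd_iff_tight:
  assumes "simple_graph G" "connected_graph G" "3 \<le> card (vertices G)"
    and "e0 \<in> edges G" "f0 \<in> edges G" "e0 \<noteq> f0"
  shows "critical 2 G \<and> domination_subdivision_number G = 2 \<longleftrightarrow> tight G (domination_number G)"
proof -
  let ?g = "domination_number G"
  let ?S = "{F. F \<subseteq> edges G \<and> domination_number (subdivide G F) > ?g}"
  have gt: "domination_number (subdivide G F) > ?g \<longleftrightarrow> \<not> dom_le G F ?g" if "F \<subseteq> edges G" for F
    using domination_number_subdivide_le_iff[OF assms(1) that] by (meson not_le)
  have S: "?S = {F. F \<subseteq> edges G \<and> \<not> dom_le G F ?g}"
    using gt by blast
  have g: "dom_le G {} ?g" "m < ?g \<Longrightarrow> \<not> dom_le G {} m" for m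
    using domination_number_le_iff_dom_le[OF assms(1)] by (auto simp: not_le[symmetric])
  have finE: "finite (edges G)"
    using assms(1) by (rule finite_edges)
  show ?thesis
  proof
    assume L: "critical 2 G \<and> domination_subdivision_number G = 2"
    have "dom_le G {e} ?g" if e: "e \<in> edges G" for e
    proof (rule ccontr)
      assume "\<not> dom_le G {e} ?g"
      then have "{e} \<in> ?S" using e S by auto
      then have "Inf (card ` ?S) \<le> card {e}" by (intro cInf_lower imageI) auto
      then show False using L unfolding domination_subdivision_number_def by simp
    qed
    moreover have "\<not> dom_le G {e, f} ?g" if "e \<in> edges G" "f \<in> edges G" "e \<noteq> f" for e f
    proof -
      have "{e, f} \<subseteq> edges G \<and> card {e, f} = 2" using that by auto
      then show ?thesis using L gt[of "{e, f}"] unfolding critical_def by blast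
    qed
    ultimately show "tight G ?g" using g unfolding tight_def by blast
  next
    assume t: "tight G ?g"
    have big: "2 \<le> card F" if "F \<in> ?S" for F
    proof (rule ccontr)
      assume "\<not> 2 \<le> card F"
      moreover have F: "F \<subseteq> edges G" "\<not> dom_le G F ?g" using that S by auto
      moreover have "finite F" using F finE finite_subset by blast
      ultimately have "F = {} \<or> (\<exists>e\<in>edges G. F = {e})"
        by (auto simp: not_le less_2_cases_iff card_1_singleton_iff)
      then show False using F t unfolding tight_def by blast
    qed
    have pair: "domination_number (subdivide G F) > ?g" if "F \<subseteq> edges G" "card F = 2" for F
    proof -
      obtain e f where "F = {e, f}" "e \<noteq> f" using \<open>card F = 2\<close> by (auto simp: card_2_iff)
      then show ?thesis using \<open>F \<subseteq> edges G\<close> t gt[of F] unfolding tight_def by blast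
    qed
    \<comment> \<open>The minimum has to be attained: over an empty set \<open>Inf\<close> would be
      0.\<close>
    have "{e0, f0} \<in> ?S"
      using pair[of "{e0, f0}"] assms(4-6) by auto
    then have "card {e0, f0} \<in> card ` ?S" by (rule imageI)
    moreover have "card {e0, f0} = 2" using assms(6) by simp
    ultimately have "2 \<in> card ` ?S" by (simp only:)
    then have "domination_subdivision_number G = 2"
      unfolding domination_subdivision_number_def
      by (intro cInf_eq_minimum) (use big in auto)
    moreover have "domination_number (subdivide G {e0}) = ?g"
    proof (rule antisym)
      show "domination_number (subdivide G {e0}) \<le> ?g"
        using t assms(4) gt[of "{e0}"] by (simp add: tight_def)
      obtain A X where AX: "dset G {e0} A X"
          "card A + card X \<le> domination_number (subdivide G {e0})"
        using domination_number_subdivide_le_iff[OF assms(1), of "{e0}"] assms(4)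
        by (metis dom_leE empty_subsetI insert_subset order_refl)
      obtain u v where uv: "e0 = {u, v}" "u \<in> vertices G" "v \<in> vertices G"
        using assms(1,4) unfolding simple_graph_def card_2_iff by fastforce
      have fA: "finite A"
        using AX(1) assms(1) unfolding dset_def simple_graph_def by (meson finite_subset)
      \<comment> \<open>A subdivision never lowers the number: a chosen new vertex dominates only
        itself and the ends \<open>u\<close>, \<open>v\<close>, and in \<open>G\<close> the vertex
        \<open>u\<close> dominates both ends.\<close>
      have "dom_le G {} (card A + card X)"
      proof (cases "X = {}")
        case True
        then have "dset G {} A {}" using AX(1) unfolding dset_def by auto
        then show ?thesis using True by (intro dom_leI) auto
      next
        case False
        then have X: "X = {e0}" using AX(1) unfolding dset_def by auto
        have "dset G {} (insert u A) {}"
          using AX(1) uv assms(4) unfolding dset_def X by (auto simp: insert_commute)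
        then show ?thesis using X fA by (intro dom_leI) (auto simp: card_insert_if)
      qed
      then show "?g \<le> domination_number (subdivide G {e0})"
        using AX(2) domination_number_le_iff_dom_le[OF assms(1)] by (meson le_trans)
    qed
    ultimately show "critical 2 G \<and> domination_subdivision_number G = 2"
      using assms(1-4) pair unfolding critical_def by (intro conjI exI[of _ "{e0}"]) auto
  qed
qed

section \<open>Leaves and pendant paths\<close>

definition nbrs :: "'a sgraph \<Rightarrow> 'a \<Rightarrow> 'a set" where
  "nbrs G u = {v. {u, v} \<in> edges G}"

definition remove :: "'a sgraph \<Rightarrow> 'a set \<Rightarrow> 'a sgraph" where
  "remove G S = \<lparr>vertices = vertices G - S, edges = {e \<in> edges G. e \<inter> S = {}}\<rparr>"

lemma nbrs_sym: "v \<in> nbrs G u \<longleftrightarrow> u \<in> nbrs G v"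
  by (simp add: nbrs_def insert_commute)

lemma edge_iff_nbrs: "{u, v} \<in> edges G \<longleftrightarrow> v \<in> nbrs G u"
  by (simp add: nbrs_def)

lemma nbrs_vertices: "simple_graph G \<Longrightarrow> v \<in> nbrs G u \<Longrightarrow> u \<in> vertices G \<and> v \<in> vertices G \<and> u \<noteq> v"
  by (fastforce simp: nbrs_def simple_graph_def)

lemma edgeE:
  assumes "simple_graph G" "e \<in> edges G"
  obtains u v where "e = {u, v}" "v \<in> nbrs G u" "u \<noteq> v"
proof -
  have "card e = 2" using assms by (simp add: simple_graph_def)
  then obtain u v where "e = {u, v}" "u \<noteq> v" by (auto simp: card_2_iff)
  then show thesis using assms(2) by (intro that[of u v]) (auto simp: nbrs_def)
qed

lemma edge_at:
  assumes "simple_graph G" "e \<in> edges G" "u \<in> e"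
  obtains v where "e = {u, v}" "v \<in> nbrs G u"
proof -
  obtain x y where xy: "e = {x, y}" "y \<in> nbrs G x" using assms(1,2) by (rule edgeE)
  then have "x \<in> nbrs G y" by (simp add: nbrs_sym)
  then show thesis using xy assms(3) that[of x] that[of y] by (auto simp: insert_commute)
qed

text \<open>Adjacency is read from the dominated vertex \<open>v\<close>, so that a known
  neighbourhood such as \<open>nbrs G a = {s}\<close> evaluates the condition by rewriting.\<close>

lemma dset_nbrs:
  "dset G F A X \<longleftrightarrow> A \<subseteq> vertices G \<and> X \<subseteq> F \<and>
     (\<forall>v\<in>vertices G - A. (\<exists>u\<in>A. u \<in> nbrs G v \<and> {u, v} \<notin> F) \<or> (\<exists>e\<in>X. v \<in> e)) \<and>
     (\<forall>e\<in>F - X. e \<inter> A \<noteq> {})"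
proof -
  have "{u, v} \<in> edges G \<longleftrightarrow> u \<in> nbrs G v" for u v
    using edge_iff_nbrs nbrs_sym by metis
  then show ?thesis unfolding dset_def by simp
qed

lemma dset_vertexD:
  "dset G F A X \<Longrightarrow> v \<in> vertices G \<Longrightarrow> v \<notin> A \<Longrightarrow>
    (\<exists>u\<in>A. u \<in> nbrs G v \<and> {u, v} \<notin> F) \<or> (\<exists>e\<in>X. v \<in> e)"
  by (simp add: dset_nbrs)

text \<open>The count behind the local replacements below: the part of \<open>A\<close> inside
  \<open>S\<close> gives way to \<open>N\<close>, and \<open>P\<close> lists elements that are
  certainly given up.\<close>

lemma card_exchange:
  assumes "finite A" "finite N" "P \<subseteq> A \<inter> S"
  shows "card (A - S \<union> N) + card P \<le> card A + card N"
proof -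
  have "card A = card (A \<inter> S) + card (A - S)"
    using assms(1) by (rule card_Int_Diff)
  moreover have "card P \<le> card (A \<inter> S)"
    using assms by (intro card_mono) auto
  moreover have "card (A - S \<union> N) \<le> card (A - S) + card N"
    by (rule card_Un_le)
  ultimately show ?thesis by linarith
qed

text \<open>With \<open>as\<close> subdivided, two chosen vertices are spent on \<open>a\<close>,
  \<open>b\<close>, \<open>s\<close> and the new vertex. In \<open>G\<close> the vertex
  \<open>s\<close> replaces them both.\<close>

lemma dom_le_two_leaves:
  assumes G: "simple_graph G" and a: "nbrs G a = {s}" and b: "nbrs G b = {s}" and "a \<noteq> b"
    and "dom_le G {{a, s}} n"
  shows "\<exists>m<n. dom_le G {} m"
proof -
  obtain A X where AX: "dset G {{a, s}} A X" "card A + card X \<le> n"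
    using assms(5) by (rule dom_leE)
  have V: "s \<in> vertices G" "a \<in> vertices G" "b \<in> vertices G" "a \<noteq> s" "b \<noteq> s"
    using nbrs_vertices[OF G] a b by blast+
  have ne: "{b, s} \<noteq> {a, s}" using \<open>a \<noteq> b\<close> V by (simp add: doubleton_eq_iff)
  have fA: "finite A" using AX(1) G unfolding dset_def simple_graph_def by (meson finite_subset)
  have X: "X = {} \<or> X = {{a, s}}" using AX(1) by (auto simp: dset_def)
  have hb: "b \<in> A \<or> s \<in> A" and ha: "X = {} \<Longrightarrow> a \<in> A"
    using AX(1) V \<open>a \<noteq> b\<close> a b unfolding dset_nbrs by auto
  let ?S = "{a, b, s}"
  obtain P where P: "P \<subseteq> A \<inter> ?S" "card P + card X = 2"
  proof (cases "X = {}")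
    case True
    then have "\<exists>y\<in>{b, s}. y \<in> A" "a \<in> A" using ha hb by auto
    then obtain y where "y \<in> {b, s}" "y \<in> A" by blast
    then show ?thesis using True \<open>a \<in> A\<close> V \<open>a \<noteq> b\<close> by (intro that[of "{a, y}"]) auto
  next
    case False
    obtain y where "y \<in> {b, s}" "y \<in> A" using hb by blast
    then show ?thesis using False X by (intro that[of "{y}"]) auto
  qed
  have "dset G {} (A - ?S \<union> {s}) {}"
    unfolding dset_nbrs
  proof (intro conjI ballI)
    show "A - ?S \<union> {s} \<subseteq> vertices G" using AX(1) V by (auto simp: dset_def)
    fix v assume v: "v \<in> vertices G - (A - ?S \<union> {s})"
    show "(\<exists>u\<in>A - ?S \<union> {s}. u \<in> nbrs G v \<and> {u, v} \<notin> {}) \<or> (\<exists>e\<in>{}. v \<in> e)"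
    proof (cases "v \<in> {a, b}")
      case True
      then show ?thesis using a b by auto
    next
      case False
      then obtain u where u: "u \<in> A" "u \<in> nbrs G v" using dset_vertexD[OF AX(1), of v] v X by blast
      then have "v \<in> nbrs G u" by (simp add: nbrs_sym)
      then have "u \<noteq> a" "u \<noteq> b" using a b v by auto
      then show ?thesis using u by auto
    qed
  qed auto
  moreover have "card (A - ?S \<union> {s}) + card P \<le> card A + card {s}"
    using fA P by (intro card_exchange) auto
  ultimately show ?thesis
    using P AX(2) by (intro exI[of _ "card (A - ?S \<union> {s})"]) (auto intro: dom_leI)
qed

text \<open>The leaves force one chosen vertex in \<open>{a, s}\<close> and one in
  \<open>{b, t}\<close>. Exchange them for the new vertex on \<open>as\<close>, which dominates
  \<open>a\<close> and \<open>s\<close>, and for \<open>t\<close>, which dominates \<open>b\<close>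
  and the new vertex on \<open>st\<close>.\<close>

lemma dom_le_leaf_at:
  assumes G: "simple_graph G" and a: "nbrs G a = {s}" and s: "nbrs G s = {a, t}"
    and b: "nbrs G b = {t}" and ne: "s \<noteq> b" "a \<noteq> t" and "dom_le G {} n"
  shows "dom_le G {{a, s}, {s, t}} n"
proof -
  obtain A X where AX: "dset G {} A X" "card A + card X \<le> n"
    using assms(7) by (rule dom_leE)
  have V: "s \<in> vertices G" "a \<in> vertices G" "b \<in> vertices G" "t \<in> vertices G"
    "a \<noteq> s" "s \<noteq> t" "b \<noteq> t" "a \<noteq> b"
    using nbrs_vertices[OF G] a s b ne by blast+
  have fA: "finite A" using AX(1) G unfolding dset_def simple_graph_def by (meson finite_subset)
  have X: "X = {}" using AX(1) by (auto simp: dset_def)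
  have dA: "\<exists>u\<in>A. u \<in> nbrs G v" if "v \<in> vertices G" "v \<notin> A" for v
    using dset_vertexD[OF AX(1), of v] X that by blast
  obtain y where y: "y \<in> {a, s}" "y \<in> A" using dA[of a] V a by auto
  obtain z where z: "z \<in> {b, t}" "z \<in> A" using dA[of b] V b by auto
  let ?S = "{a, s, b, t}"
  have "dset G {{a, s}, {s, t}} (A - ?S \<union> {t}) {{a, s}}"
    unfolding dset_nbrs
  proof (intro conjI ballI)
    show "A - ?S \<union> {t} \<subseteq> vertices G" using AX(1) V by (auto simp: dset_def)
    fix v assume v: "v \<in> vertices G - (A - ?S \<union> {t})"
    show "(\<exists>u\<in>A - ?S \<union> {t}. u \<in> nbrs G v \<and> {u, v} \<notin> {{a, s}, {s, t}}) \<or> (\<exists>e\<in>{{a, s}}. v \<in> e)"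
    proof (cases "v \<in> {a, s, b}")
      case True
      then show ?thesis using b V ne by (auto simp: doubleton_eq_iff)
    next
      case False
      then obtain u where u: "u \<in> A" "u \<in> nbrs G v" using dA[of v] v by auto
      then have "v \<in> nbrs G u" by (simp add: nbrs_sym)
      then have "u \<notin> {a, s, b}" using a s b v False by auto
      then show ?thesis using u v False by (auto simp: doubleton_eq_iff)
    qed
  qed auto
  moreover have "card (A - ?S \<union> {t}) + card {y, z} \<le> card A + card {t}"
    using fA y z by (intro card_exchange) auto
  moreover have "card {y, z} = 2" using y z V ne by auto
  ultimately show ?thesis using AX(2) X by (auto intro: dom_leI)
qed

text \<open>Each pendant path contains a chosen vertex. Exchange the two for the new vertex on
  \<open>as\<close>, which dominates \<open>a\<close> and \<open>s\<close>, and for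
  \<open>r\<close>, which dominates \<open>b\<close> and \<open>t\<close>; then \<open>s\<close> is
  needed neither by \<open>a\<close> nor by \<open>t\<close>.\<close>

lemma dom_le_two_pendant_paths:
  assumes G: "simple_graph G" and a: "nbrs G a = {s}" and s: "nbrs G s = {a, t}"
    and b: "nbrs G b = {r}" and r: "nbrs G r = {b, t}" and ne: "a \<noteq> t" "b \<noteq> t" "s \<noteq> r"
    and e: "e \<in> edges G" "e \<notin> {{a, s}, {s, t}, {t, r}, {r, b}}"
    and "dom_le G {e} n"
  shows "dom_le G {e, {a, s}} n"
proof -
  obtain A X where AX: "dset G {e} A X" "card A + card X \<le> n"
    using assms(11) by (rule dom_leE)
  have V: "s \<in> vertices G" "a \<in> vertices G" "b \<in> vertices G" "t \<in> vertices G" "r \<in> vertices G"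
    "a \<noteq> s" "s \<noteq> t" "r \<noteq> t" "b \<noteq> r"
    using nbrs_vertices[OF G] a s b r by blast+
  have ab: "a \<noteq> b" "a \<noteq> r" "b \<noteq> s" using a b s r ne by (metis doubleton_eq_iff singleton_insert_inj_eq')+
  have fA: "finite A" using AX(1) G unfolding dset_def simple_graph_def by (meson finite_subset)
  have X: "X = {} \<or> X = {e}" "finite X" using AX(1) finite_subset[of X "{e}"] by (auto simp: dset_def)
  \<comment> \<open>The excluded edges are all the edges at these four vertices; \<open>e\<close>
    may still end in \<open>t\<close>, which the exchange leaves untouched.\<close>
  have en: "e \<inter> {a, s, b, r} = {}"
  proof (rule ccontr)
    assume "e \<inter> {a, s, b, r} \<noteq> {}"
    then obtain x where x: "x \<in> {a, s, b, r}" "x \<in> e" by auto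
    obtain y where y: "e = {x, y}" "y \<in> nbrs G x" using edge_at[OF G e(1) x(2)] by blast
    have "(x, y) \<in> {(a, s), (s, a), (s, t), (b, r), (r, b), (r, t)}"
      using x(1) y(2) by (elim insertE emptyE) (auto simp: a s b r)
    then have "e \<in> {{a, s}, {s, t}, {t, r}, {r, b}}" unfolding y(1) by (auto simp: doubleton_eq_iff)
    then show False using e(2) by contradiction
  qed
  have dA: "\<exists>u\<in>A. u \<in> nbrs G v" if "v \<in> {a, b}" "v \<notin> A" for v
  proof -
    have "v \<in> vertices G - A" "v \<notin> e" using that V en by auto
    then show ?thesis using dset_vertexD[OF AX(1), of v] X(1) by blast
  qed
  obtain y where y: "y \<in> {a, s}" "y \<in> A" using dA[of a] a by auto
  obtain z where z: "z \<in> {b, r}" "z \<in> A" using dA[of b] b by auto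
  let ?S = "{a, s, b, r}"
  have tr: "r \<in> nbrs G t" "r \<in> nbrs G b" "{r, t} \<notin> {e, {a, s}}" "{r, b} \<notin> {e, {a, s}}"
    using r b e(2) V ab ne nbrs_sym[of r G t] by (auto simp: insert_commute doubleton_eq_iff)
  have "dset G {e, {a, s}} (A - ?S \<union> {r}) (insert {a, s} X)"
    unfolding dset_nbrs
  proof (intro conjI ballI)
    show "A - ?S \<union> {r} \<subseteq> vertices G" using AX(1) V by (auto simp: dset_def)
    show "insert {a, s} X \<subseteq> {e, {a, s}}" using X by auto
    show "f \<inter> (A - ?S \<union> {r}) \<noteq> {}" if "f \<in> {e, {a, s}} - insert {a, s} X" for f
    proof -
      have "f = e" "e \<notin> X" using that by auto
      then have "e \<inter> A \<noteq> {}" using AX(1) by (auto simp: dset_def)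
      then show ?thesis using en \<open>f = e\<close> by blast
    qed
    fix v assume v: "v \<in> vertices G - (A - ?S \<union> {r})"
    show "(\<exists>u\<in>A - ?S \<union> {r}. u \<in> nbrs G v \<and> {u, v} \<notin> {e, {a, s}}) \<or> (\<exists>e\<in>insert {a, s} X. v \<in> e)"
    proof (cases "v \<in> {a, s, b, r, t}")
      case True
      moreover have "v \<noteq> r" using v by simp
      ultimately consider "v = a \<or> v = s" | "v = b \<or> v = t" by auto
      then show ?thesis
      proof cases
        case 1
        then show ?thesis by auto
      next
        case 2
        then have "r \<in> nbrs G v" "{r, v} \<notin> {e, {a, s}}" using tr by metis+
        then show ?thesis by (intro disjI1 bexI[of _ r] conjI) simp_all
      qed
    next
      case False
      then have v': "v \<in> vertices G" "v \<notin> A" using v by auto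
      have ne': "{u, v} \<noteq> {a, s}" for u using False by auto
      consider u where "u \<in> A" "u \<in> nbrs G v" "{u, v} \<noteq> e" | "\<exists>e\<in>X. v \<in> e"
        using dset_vertexD[OF AX(1) v'] by auto
      then show ?thesis
      proof cases
        case 1
        then have "v \<in> nbrs G u" by (simp add: nbrs_sym)
        then have "u \<notin> ?S" using False a s b r by auto
        then show ?thesis using 1 ne' by auto
      qed auto
    qed
  qed
  moreover have "card (A - ?S \<union> {r}) + card {y, z} \<le> card A + card {r}"
    using fA y z by (intro card_exchange) auto
  moreover have "card {y, z} = 2" using y z V ne ab by auto
  moreover have "card (insert {a, s} X) \<le> card X + 1" using X by (auto simp: card_insert_if)
  ultimately show ?thesis
    using AX(2) by (intro dom_leI[where A = "A - ?S \<union> {r}" and X = "insert {a, s} X"]) simp_all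
qed

text \<open>The path \<open>a, s, t\<close> hangs at \<open>p\<close>, and \<open>Q\<close> below is the rest of the graph.\<close>

locale pendant =
  fixes G :: "'a sgraph" and a s t p :: 'a
  assumes G: "simple_graph G" and a: "nbrs G a = {s}" and s: "nbrs G s = {a, t}"
    and t: "nbrs G t = {s, p}" and ne: "a \<noteq> t" "s \<noteq> p" "a \<noteq> p"
begin

definition Q where "Q = remove G {a, s, t}"

lemma V: "a \<in> vertices G" "s \<in> vertices G" "t \<in> vertices G" "p \<in> vertices G"
  "a \<noteq> s" "s \<noteq> t" "t \<noteq> p"
  using nbrs_vertices[OF G] a s t by blast+

lemma VQ: "vertices Q = vertices G - {a, s, t}" and EQ: "edges Q = {e\<in>edges G. e \<inter> {a, s, t} = {}}"
  by (auto simp: Q_def remove_def)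

lemma simple_Q: "simple_graph Q"
  using G unfolding simple_graph_def VQ EQ by auto

lemma edges_G: "edges G = edges Q \<union> {{a, s}, {s, t}, {t, p}}"
proof -
  have "e \<in> {{a, s}, {s, t}, {t, p}}" if e: "e \<in> edges G" "e \<inter> {a, s, t} \<noteq> {}" for e
  proof -
    obtain x where x: "x \<in> {a, s, t}" "x \<in> e" using e(2) by auto
    obtain y where y: "e = {x, y}" "y \<in> nbrs G x" using edge_at[OF G e(1) x(2)] by blast
    have "(x, y) \<in> {(a, s), (s, a), (s, t), (t, s), (t, p)}"
      using x(1) y(2) by (elim insertE emptyE) (auto simp: a s t)
    then show ?thesis unfolding y(1) by (auto simp: doubleton_eq_iff)
  qed
  moreover have "{{a, s}, {s, t}, {t, p}} \<subseteq> edges G"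
    using a s t by (auto simp: edge_iff_nbrs)
  ultimately show ?thesis unfolding EQ by auto
qed

lemma nbrs_Q: "nbrs Q v = nbrs G v - {a, s, t}" if "v \<in> vertices Q"
  using that by (auto simp: nbrs_def VQ EQ)

lemma p_Q: "p \<in> vertices Q"
  using V ne by (simp add: VQ)

lemma finite_G: "finite (vertices G)"
  using G by (simp add: simple_graph_def)

section \<open>Dominating sets of a graph and of the rest after removing a pendant path\<close>

text \<open>The single vertex \<open>s\<close> dominates all three removed vertices, and no edge of
  \<open>F\<close> touches them.\<close>

lemma dset_insert:
  assumes "dset Q F A X" "F \<subseteq> edges Q"
  shows "dset G F (insert s A) X"
  unfolding dset_nbrs
proof (intro conjI ballI)
  show "insert s A \<subseteq> vertices G" "X \<subseteq> F" using assms V by (auto simp: dset_def VQ)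
  show "e \<inter> insert s A \<noteq> {}" if "e \<in> F - X" for e using assms that by (auto simp: dset_def)
  fix v assume v: "v \<in> vertices G - insert s A"
  show "(\<exists>u\<in>insert s A. u \<in> nbrs G v \<and> {u, v} \<notin> F) \<or> (\<exists>e\<in>X. v \<in> e)"
  proof (cases "v \<in> {a, t}")
    case True
    then show ?thesis using assms(2) a t by (auto simp: EQ)
  next
    case False
    then have v': "v \<in> vertices Q" "v \<notin> A" using v by (auto simp: VQ)
    show ?thesis using dset_vertexD[OF assms(1) v'] nbrs_Q[OF v'(1)] by (metis DiffE insertI2)
  qed
qed

lemma dom_le_add: "dom_le Q F m \<Longrightarrow> F \<subseteq> edges Q \<Longrightarrow> dom_le G F (Suc m)"
proof (elim dom_leE)
  fix A X assume *: "dset Q F A X" "card A + card X \<le> m" "F \<subseteq> edges Q"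
  have "card (insert s A) \<le> Suc (card A)"
    by (cases "finite A") (auto simp: card_insert_if)
  then show ?thesis using dset_insert[OF *(1,3)] *(2) by (intro dom_leI) auto
qed

text \<open>Since \<open>p\<close> already dominates \<open>t\<close>, the vertex \<open>s\<close>
  is left with \<open>a\<close> and the new vertex on \<open>st\<close>: this subdivision is
  free.\<close>

lemma dset_insert_st:
  assumes "dset Q F A X" "F \<subseteq> edges Q" "p \<in> A"
  shows "dset G (insert {s, t} F) (insert s A) X"
proof -
  have e: "{s, a} \<notin> insert {s, t} F" "{p, t} \<notin> insert {s, t} F"
    using assms(2) V ne unfolding EQ by (auto simp: doubleton_eq_iff)
  show ?thesis
    unfolding dset_nbrs
  proof (intro conjI ballI)
    show "insert s A \<subseteq> vertices G" "X \<subseteq> insert {s, t} F" using assms V by (auto simp: dset_def VQ)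
    show "f \<inter> insert s A \<noteq> {}" if "f \<in> insert {s, t} F - X" for f
      using assms that by (auto simp: dset_def)
    fix v assume v: "v \<in> vertices G - insert s A"
    show "(\<exists>u\<in>insert s A. u \<in> nbrs G v \<and> {u, v} \<notin> insert {s, t} F) \<or> (\<exists>e\<in>X. v \<in> e)"
    proof (cases "v \<in> {a, t}")
      case True
      then consider "v = a" | "v = t" by blast
      then show ?thesis
      proof cases
        case 1
        then show ?thesis using e a by (intro disjI1 bexI[of _ s] conjI) simp_all
      next
        case 2
        then show ?thesis using e t assms(3) by (intro disjI1 bexI[of _ p] conjI) simp_all
      qed
    next
      case False
      then have v': "v \<in> vertices Q" "v \<notin> A" using v by (auto simp: VQ)
      have "{u, v} \<noteq> {s, t}" for u using v False by auto
      then show ?thesis using dset_vertexD[OF assms(1) v'] nbrs_Q[OF v'(1)] by auto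
    qed
  qed
qed

lemma dom_le_strip:
  assumes "dom_le G F n" "F \<subseteq> edges Q"
  shows "\<exists>m<n. dom_le Q F m"
proof -
  obtain A X where AX: "dset G F A X" "card A + card X \<le> n"
    using assms(1) by (rule dom_leE)
  have fA: "finite A" using AX(1) finite_G unfolding dset_def by (meson finite_subset)
  have XF: "X \<subseteq> F" using AX(1) by (simp add: dset_def)
  have dA: "(\<exists>u\<in>A. u \<in> nbrs G v \<and> {u, v} \<notin> F) \<or> (\<exists>e\<in>X. v \<in> e)"
    if "v \<in> vertices G" "v \<notin> A" for v
    using dset_vertexD[OF AX(1)] that by blast
  have "a \<in> A \<or> s \<in> A"
  proof (rule ccontr)
    assume "\<not> (a \<in> A \<or> s \<in> A)"
    then obtain e where "e \<in> X" "a \<in> e" using dA[of a] V a by auto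
    then show False using XF assms(2) by (auto simp: EQ)
  qed
  then obtain y where y: "y \<in> {a, s}" "y \<in> A" by auto
  let ?S = "{a, s, t}" and ?N = "if t \<in> A then {p} else {}"
  have "dset Q F (A - ?S \<union> ?N) X"
    unfolding dset_nbrs
  proof (intro conjI ballI)
    show "A - ?S \<union> ?N \<subseteq> vertices Q" using AX(1) V p_Q by (auto simp: dset_def VQ)
    show "X \<subseteq> F" by fact
    show "f \<inter> (A - ?S \<union> ?N) \<noteq> {}" if "f \<in> F - X" for f
    proof -
      have "f \<inter> A \<noteq> {}" "f \<inter> ?S = {}" using that AX(1) assms(2) by (auto simp: dset_def EQ)
      then show ?thesis by blast
    qed
    fix v assume v: "v \<in> vertices Q - (A - ?S \<union> ?N)"
    then consider u where "u \<in> A" "u \<in> nbrs G v" "{u, v} \<notin> F" | "\<exists>e\<in>X. v \<in> e"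
      using dA[of v] unfolding VQ by blast
    then show "(\<exists>u\<in>A - ?S \<union> ?N. u \<in> nbrs Q v \<and> {u, v} \<notin> F) \<or> (\<exists>e\<in>X. v \<in> e)"
    proof cases
      case 1
      then have "v \<in> nbrs G u" by (simp add: nbrs_sym)
      then have "u \<notin> ?S" using v a s t 1 by (auto simp: VQ split: if_splits)
      then show ?thesis using 1 v by (auto simp: nbrs_Q)
    qed auto
  qed
  then have *: "dom_le Q F (card (A - ?S \<union> ?N) + card X)" by (intro dom_leI) auto
  have "card (A - ?S \<union> ?N) < card A"
  proof (cases "t \<in> A")
    case True
    then have "card (A - ?S \<union> {p}) + card {y, t} \<le> card A + card {p}"
      using fA y by (intro card_exchange) auto
    moreover have "card {y, t} = 2" using y V ne by auto
    ultimately show ?thesis using True by auto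
  next
    case False
    have "card (A - ?S \<union> {}) + card {y} \<le> card A + card ({} :: 'a set)"
      using fA y by (intro card_exchange) auto
    then show ?thesis using False by auto
  qed
  then show ?thesis using * AX(2) by (intro exI[of _ "card (A - ?S \<union> ?N) + card X"]) auto
qed

text \<open>The leaf \<open>a\<close> forces a chosen vertex in \<open>{a, s}\<close>, and the new
  vertex on \<open>tp\<close> forces another among \<open>t\<close>, \<open>p\<close> and itself. In
  \<open>Q\<close> the vertex \<open>p\<close> does the work of both.\<close>

lemma dset_strip_tp:
  assumes "dom_le G {{t, p}} n"
  shows "\<exists>A. dset Q {} A {} \<and> p \<in> A \<and> card A < n"
proof -
  obtain A X where AX: "dset G {{t, p}} A X" "card A + card X \<le> n"
    using assms(1) by (rule dom_leE)
  have fA: "finite A" using AX(1) finite_G unfolding dset_def by (meson finite_subset)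
  have X: "X = {} \<or> X = {{t, p}}" using AX(1) by (auto simp: dset_def)
  let ?S = "{a, s, t, p}"
  have nb: "{s, a} \<noteq> {t, p}" "{s, t} \<noteq> {t, p}" using V ne by (auto simp: doubleton_eq_iff)
  have dA: "(\<exists>u\<in>A. u \<in> nbrs G v \<and> {u, v} \<noteq> {t, p}) \<or> (\<exists>e\<in>X. v \<in> e)" if "v \<in> vertices G" "v \<notin> A" for v
    using dset_vertexD[OF AX(1)] that by blast
  have y: "a \<in> A \<or> s \<in> A"
    using dA[of a] V X ne a by auto
  have tt: "t \<in> A \<or> s \<in> A \<or> X = {{t, p}}"
    using dA[of t] V X ne t by auto
  have x: "t \<in> A \<or> p \<in> A \<or> X = {{t, p}}"
    using AX(1) X unfolding dset_def by auto
  have "dset Q {} (A - ?S \<union> {p}) {}"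
    unfolding dset_nbrs
  proof (intro conjI ballI)
    show "A - ?S \<union> {p} \<subseteq> vertices Q" using AX(1) V p_Q by (auto simp: dset_def VQ)
    fix v assume v: "v \<in> vertices Q - (A - ?S \<union> {p})"
    then have "v \<in> vertices G" "v \<notin> A" "v \<noteq> p" "v \<notin> {a, s, t}" unfolding VQ by auto
    moreover from calculation obtain u where u: "u \<in> A" "u \<in> nbrs G v" using dA[of v] X by auto
    moreover from u have "v \<in> nbrs G u" by (simp add: nbrs_sym)
    ultimately have "u \<notin> {a, s, t}" using a s t by auto
    then have "u \<in> A - ?S \<union> {p}" "u \<in> nbrs Q v" using u v by (auto simp: nbrs_Q)
    then show "(\<exists>u\<in>A - ?S \<union> {p}. u \<in> nbrs Q v \<and> {u, v} \<notin> {}) \<or> (\<exists>e\<in>{}. v \<in> e)"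
      by auto
  qed auto
  moreover have "card (A - ?S \<union> {p}) < n"
  proof -
    obtain P where P: "P \<subseteq> A \<inter> ?S" "card P + card X = 2"
    proof (cases "X = {}")
      case True
      obtain y where y: "y \<in> {a, s}" "y \<in> A" using y by auto
      obtain z where z: "z \<in> {t, p}" "z \<in> A" using x True by auto
      have "card {y, z} = 2" using y z V ne by auto
      then show ?thesis using True y z by (intro that[of "{y, z}"]) auto
    next
      case False
      obtain y where "y \<in> {a, s}" "y \<in> A" using y by auto
      then show ?thesis using False X by (intro that[of "{y}"]) auto
    qed
    have "card (A - ?S \<union> {p}) + card P \<le> card A + card {p}"
      using fA P by (intro card_exchange) auto
    then show ?thesis using P AX(2) by auto
  qed
  ultimately show ?thesis by blast
qed

lemma tight_strip:
  assumes "tight G n"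
  obtains m where "n = Suc m" "tight Q m"
proof -
  obtain m where m: "m < n" "dom_le Q {} m"
    using dom_le_strip[OF tight_dom_le[OF assms]] by auto
  have "dom_le G {} (Suc m)" using dom_le_add[OF m(2)] by simp
  \<comment> \<open>Stripping saves at least one vertex, and putting \<open>s\<close> back costs at
    most one.\<close>
  then have n: "n = Suc m" using tight_not_dom_le_less[OF assms] m(1) by (metis Suc_lessI)
  have sub: "e \<in> edges G" if "e \<in> edges Q" for e using that by (simp add: EQ)
  have "tight Q m"
    unfolding tight_def
  proof (intro conjI allI impI ballI)
    show "dom_le Q {} m" by fact
    show "\<not> dom_le Q {} i" if "i < m" for i
      using dom_le_add[of "{}" i] tight_not_dom_le_less[OF assms, of "Suc i"] that n by auto
    show "dom_le Q {e} m" if e: "e \<in> edges Q" for e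
    proof -
      obtain i where "i < n" "dom_le Q {e} i"
        using dom_le_strip[OF tight_dom_le_edge[OF assms sub[OF e]]] e by auto
      moreover from this obtain A X where "dset Q {e} A X" "card A + card X \<le> i"
        by (elim dom_leE)
      ultimately show ?thesis using n by (intro dom_leI) auto
    qed
    show "\<not> dom_le Q {e, f} m" if ef: "e \<in> edges Q" "f \<in> edges Q" "e \<noteq> f" for e f
    proof
      assume "dom_le Q {e, f} m"
      then have "dom_le G {e, f} n" using dom_le_add[of "{e, f}" m] ef n by simp
      then show False using tight_not_dom_le_pair[OF assms sub[OF ef(1)] sub[OF ef(2)] ef(3)] by contradiction
    qed
  qed
  then show thesis using n that by blast
qed

end

section \<open>Domination in paths\<close>

definition path_edges :: "'a list \<Rightarrow> 'a set set" where
  "path_edges vs = {{vs ! i, vs ! Suc i} | i. Suc i < length vs}"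

text \<open>The list stands for an isomorphism with a path: extending the path is consing, changing
  its direction is \<open>rev\<close>. As \<open>edges G\<close> contains nothing else, this is more
  than a Hamiltonian path.\<close>

definition spanning_path :: "'a sgraph \<Rightarrow> 'a list \<Rightarrow> bool" where
  "spanning_path G vs \<longleftrightarrow> distinct vs \<and> set vs = vertices G \<and> edges G = path_edges vs"

lemma path_edges_Nil [simp]: "path_edges [] = {}"
  and path_edges_single [simp]: "path_edges [x] = {}"
  by (auto simp: path_edges_def)

lemma path_edges_Cons [simp]: "path_edges (x # y # zs) = insert {x, y} (path_edges (y # zs))"
proof (intro equalityI subsetI)
  fix e assume "e \<in> path_edges (x # y # zs)"
  then obtain i where "e = {(x # y # zs) ! i, (y # zs) ! i}" "i < length (y # zs)"
    by (auto simp: path_edges_def)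
  then show "e \<in> insert {x, y} (path_edges (y # zs))"
    by (cases i) (auto simp: path_edges_def)
next
  fix e assume "e \<in> insert {x, y} (path_edges (y # zs))"
  then consider "e = {x, y}" | i where "e = {(y # zs) ! i, (y # zs) ! Suc i}" "i < length zs"
    by (auto simp: path_edges_def)
  then show "e \<in> path_edges (x # y # zs)"
  proof cases
    case 1
    then show ?thesis unfolding path_edges_def by (auto intro!: exI[of _ 0])
  next
    case (2 i)
    then show ?thesis unfolding path_edges_def by (auto intro!: exI[of _ "Suc i"])
  qed
qed

lemma path_edges_rev_subset: "path_edges vs \<subseteq> path_edges (rev vs)"
proof
  fix e assume "e \<in> path_edges vs"
  then obtain i where i: "e = {vs ! i, vs ! Suc i}" "Suc i < length vs"
    by (auto simp: path_edges_def)
  \<comment> \<open>Position of \<open>vs ! Suc i\<close> in the reversed list, where it comes first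
    of the two.\<close>
  let ?j = "length vs - Suc (Suc i)"
  have "rev vs ! ?j = vs ! Suc i" "rev vs ! Suc ?j = vs ! i" "Suc ?j < length vs"
    using i(2) by (auto simp: rev_nth Suc_diff_Suc)
  then have "e = {rev vs ! ?j, rev vs ! Suc ?j}"
    using i(1) by auto
  with \<open>Suc ?j < length vs\<close> show "e \<in> path_edges (rev vs)"
    unfolding path_edges_def length_rev by blast
qed

lemma path_edges_rev: "path_edges (rev vs) = path_edges vs"
  using path_edges_rev_subset[of vs] path_edges_rev_subset[of "rev vs"] by auto

lemma spanning_path_rev: "spanning_path G vs \<Longrightarrow> spanning_path G (rev vs)"
  by (simp add: spanning_path_def path_edges_rev)

lemma doubleton_nth_eq_iff:
  assumes "distinct vs" "i < length vs" "j < length vs" "Suc q < length vs"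
  shows "{vs ! i, vs ! j} = {vs ! q, vs ! Suc q} \<longleftrightarrow> i = q \<and> j = Suc q \<or> j = q \<and> i = Suc q"
  using assms by (auto simp: doubleton_eq_iff nth_eq_iff_index_eq)

lemma nth_edge_iff:
  assumes "distinct vs" "i < length vs" "j < length vs"
  shows "{vs ! i, vs ! j} \<in> path_edges vs \<longleftrightarrow> j = Suc i \<or> i = Suc j"
  using doubleton_nth_eq_iff[OF assms] assms(2,3) unfolding path_edges_def by auto

lemma spanning_path_simple: "spanning_path G vs \<Longrightarrow> simple_graph G"
proof -
  assume "spanning_path G vs"
  then have d: "distinct vs" "vertices G = set vs" "edges G = path_edges vs"
    by (auto simp: spanning_path_def)
  then show ?thesis
    unfolding simple_graph_def by (auto simp: path_edges_def nth_eq_iff_index_eq)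
qed

section \<open>Small dominating sets of paths with one subdivided edge\<close>

text \<open>Turns domination into arithmetic on positions. The edge from \<open>j\<close> to
  \<open>Suc j\<close> is lost exactly if \<open>j = q\<close>, the edge to \<open>j - 1\<close>
  exactly if \<open>j - 1 = q\<close>; the guard \<open>0 < j\<close> is there because
  \<open>j - 1\<close> is 0 for \<open>j = 0\<close>.\<close>

lemma dset_indices:
  assumes "spanning_path G vs" "Suc q < length vs" "I \<subseteq> {..<length vs}"
    and "e = {vs ! q, vs ! Suc q}" "X = {} \<and> (q \<in> I \<or> Suc q \<in> I) \<or> X = {e}"
    and "\<And>j. j < length vs \<Longrightarrow> j \<in> I \<or> X \<noteq> {} \<and> (j = q \<or> j = Suc q) \<or>
      Suc j \<in> I \<and> j \<noteq> q \<or> 0 < j \<and> j - 1 \<in> I \<and> j - 1 \<noteq> q"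
  shows "dset G {e} (nth vs ` I) X"
proof -
  have d: "distinct vs" "set vs = vertices G" "edges G = path_edges vs"
    using assms(1) by (auto simp: spanning_path_def)
  have "(\<exists>u\<in>nth vs ` I. {u, v} \<in> edges G - {e}) \<or> (\<exists>e\<in>X. v \<in> e)"
    if v: "v \<in> vertices G" "v \<notin> nth vs ` I" for v
  proof -
    obtain j where j: "j < length vs" "v = vs ! j" using v(1) d(2) by (metis in_set_conv_nth)
    then have "j \<notin> I" using v(2) by auto
    then consider "X = {e}" "j = q \<or> j = Suc q" | "Suc j \<in> I" "j \<noteq> q" | "0 < j" "j - 1 \<in> I" "j - 1 \<noteq> q"
      using assms(5) assms(6)[OF j(1)] by blast
    then show ?thesis
    proof cases
      case 1
      then show ?thesis using assms(4) j by auto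
    next
      case 2
      then have "Suc j < length vs" using assms(3) by auto
      then have "{vs ! Suc j, v} \<in> edges G - {e}"
        using 2 j nth_edge_iff[OF d(1), of "Suc j" j] doubleton_nth_eq_iff[OF d(1), of "Suc j" j q]
          d(3) assms(2,4) by auto
      then show ?thesis using 2 by blast
    next
      case 3
      then have "{vs ! (j - 1), v} \<in> edges G - {e}"
        using j nth_edge_iff[OF d(1), of "j - 1" j] doubleton_nth_eq_iff[OF d(1), of "j - 1" j q]
          d(3) assms(2,4) by auto
      then show ?thesis using 3 by blast
    qed
  qed
  moreover have "nth vs ` I \<subseteq> vertices G" unfolding d(2)[symmetric] using assms(3) by auto
  moreover have "X = {} \<Longrightarrow> e \<inter> nth vs ` I \<noteq> {}" using assms(4,5) by auto
  moreover have "X \<subseteq> {e}" "{e} - X = (if X = {} then {e} else {})" using assms(5) by auto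
  ultimately show ?thesis unfolding dset_def by simp
qed

text \<open>A path with \<open>3k + 2\<close> vertices is cut into \<open>k\<close> blocks of three indices and a block of two. The
  first \<open>m\<close> blocks are dominated by their middle, the later ones by their first element together
  with the first element of the next block. Hence the edges around the change are not needed.\<close>

definition blocks :: "nat \<Rightarrow> nat \<Rightarrow> nat set" where
  "blocks k m = {j. j < 3 * k + 2 \<and> (if j < 3 * m then j mod 3 = 1 else j mod 3 = 0)}"

text \<open>Written with \<open>Suc\<close> to match the neighbours of a position given by its
  residue; the fourth fact serves the right neighbour of \<open>3 * c + 2\<close>.\<close>

lemma blocks_iff:
  "3 * c \<in> blocks k m \<longleftrightarrow> m \<le> c \<and> c \<le> k"
  "Suc (3 * c) \<in> blocks k m \<longleftrightarrow> c < m \<and> c \<le> k"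
  "Suc (Suc (3 * c)) \<notin> blocks k m"
  "Suc (Suc (Suc (3 * c))) \<in> blocks k m \<longleftrightarrow> m \<le> Suc c \<and> Suc c \<le> k"
proof -
  have mod: "3 * c mod 3 = 0" "Suc (3 * c) mod 3 = 1" "Suc (Suc (3 * c)) mod 3 = 2" for c :: nat
    by presburger+
  show 0: "3 * c \<in> blocks k m \<longleftrightarrow> m \<le> c \<and> c \<le> k" for c
    unfolding blocks_def mem_Collect_eq mod by auto
  show "Suc (3 * c) \<in> blocks k m \<longleftrightarrow> c < m \<and> c \<le> k"
    unfolding blocks_def mem_Collect_eq mod by auto
  show "Suc (Suc (3 * c)) \<notin> blocks k m"
    unfolding blocks_def mem_Collect_eq mod by auto
  show "Suc (Suc (Suc (3 * c))) \<in> blocks k m \<longleftrightarrow> m \<le> Suc c \<and> Suc c \<le> k"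
  proof -
    have "Suc (Suc (Suc (3 * c))) = 3 * Suc c" by simp
    then show ?thesis using 0[of "Suc c"] by (simp only:)
  qed
qed

lemma mod_3_cases:
  obtains c where "j = 3 * c" | c where "j = Suc (3 * c)" | c where "j = Suc (Suc (3 * c))"
proof -
  have "j = 3 * (j div 3) \<or> j = Suc (3 * (j div 3)) \<or> j = Suc (Suc (3 * (j div 3)))"
    by presburger
  then show thesis using that by blast
qed

lemma card_blocks: "card (blocks k m) \<le> k + 1"
proof -
  have "blocks k m \<subseteq> (\<lambda>c. if c < m then 3 * c + 1 else 3 * c) ` {..k}"
  proof
    fix j assume "j \<in> blocks k m"
    then have "j = (if j div 3 < m then 3 * (j div 3) + 1 else 3 * (j div 3))" "j div 3 \<in> {..k}"
      unfolding blocks_def by (auto split: if_splits) presburger+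
    then show "j \<in> (\<lambda>c. if c < m then 3 * c + 1 else 3 * c) ` {..k}" by blast
  qed
  then have "card (blocks k m) \<le> card {..k}" by (rule surj_card_le[rotated]) simp
  then show ?thesis by simp
qed

lemma finite_blocks: "finite (blocks k m)"
  by (rule finite_subset[of _ "{..<3 * k + 2}"]) (auto simp: blocks_def)

text \<open>Position \<open>3 * m - 1\<close>, where the pattern changes, has both neighbours
  \<open>3 * m - 2\<close> and \<open>3 * m\<close> chosen. Either of its two edges can be given up,
  and the chosen end dominates the new vertex.\<close>

lemma dset_blocks:
  assumes "spanning_path G vs" "length vs = 3 * k + 2" "1 \<le> m" "m \<le> k"
    and "q = 3 * m - 1 \<or> q = 3 * m - 2"
  shows "dset G {{vs ! q, vs ! Suc q}} (nth vs ` blocks k m) {}"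
proof (rule dset_indices[OF assms(1) _ _ refl])
  show "Suc q < length vs" "blocks k m \<subseteq> {..<length vs}"
    using assms by (auto simp: blocks_def)
  show "{} = {} \<and> (q \<in> blocks k m \<or> Suc q \<in> blocks k m) \<or> {} = {{vs ! q, vs ! Suc q}}"
  proof -
    obtain l where "m = Suc l" using assms(3) by (cases m) auto
    then show ?thesis using assms(4,5) by (auto simp: blocks_iff)
  qed
  show "j \<in> blocks k m \<or> {} \<noteq> {} \<and> (j = q \<or> j = Suc q) \<or>
      Suc j \<in> blocks k m \<and> j \<noteq> q \<or> 0 < j \<and> j - 1 \<in> blocks k m \<and> j - 1 \<noteq> q"
    if "j < length vs" for j
    using that assms(2-5) by (cases j rule: mod_3_cases) (auto simp: blocks_iff)
qed

text \<open>Position \<open>3 * m\<close> is chosen only for itself and its right neighbour, as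
  \<open>3 * m - 1\<close> is dominated from the left. The new vertex between the two can replace
  it.\<close>

lemma dset_blocks_gap:
  assumes "spanning_path G vs" "length vs = 3 * k + 2" "m \<le> k" "q = 3 * m"
  shows "dset G {{vs ! q, vs ! Suc q}} (nth vs ` (blocks k m - {q})) {{vs ! q, vs ! Suc q}}"
proof (rule dset_indices[OF assms(1) _ _ refl])
  show "Suc q < length vs" "blocks k m - {q} \<subseteq> {..<length vs}"
    using assms by (auto simp: blocks_def)
  show "j \<in> blocks k m - {q} \<or> {{vs ! q, vs ! Suc q}} \<noteq> {} \<and> (j = q \<or> j = Suc q) \<or>
      Suc j \<in> blocks k m - {q} \<and> j \<noteq> q \<or> 0 < j \<and> j - 1 \<in> blocks k m - {q} \<and> j - 1 \<noteq> q"
    if "j < length vs" for j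
    using that assms(2-4) by (cases j rule: mod_3_cases) (auto simp: blocks_iff)
qed simp

lemma spanning_path_dom_le_edge:
  assumes "spanning_path G vs" "length vs = 3 * k + 2" "e \<in> edges G"
  shows "dom_le G {e} (k + 1)"
proof -
  obtain q where q: "e = {vs ! q, vs ! Suc q}" "Suc q < length vs"
    using assms(1,3) by (auto simp: spanning_path_def path_edges_def)
  show ?thesis
  proof (cases "q mod 3 = 0")
    case True
    define m where "m = q div 3"
    have m: "q = 3 * m" "m \<le> k" using True q(2) assms(2) by (auto simp: m_def)
    have "q \<in> blocks k m" using m by (auto simp: blocks_def)
    then have "card (blocks k m - {q}) \<le> k"
      using card_blocks[of k m] finite_blocks by simp
    then have "card (nth vs ` (blocks k m - {q})) \<le> k"
      using card_image_le[of "blocks k m - {q}" "nth vs"] finite_blocks by (meson finite_Diff le_trans)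
    then show ?thesis
      using dset_blocks_gap[OF assms(1,2) m(2,1)] q(1) by (intro dom_leI) auto
  next
    case False
    \<comment> \<open>Residue 1 gives \<open>q = 3 * m - 2\<close> and residue 2 gives
      \<open>q = 3 * m - 1\<close>.\<close>
    define m where "m = q div 3 + 1"
    have m: "1 \<le> m" "m \<le> k" "q = 3 * m - 1 \<or> q = 3 * m - 2"
      using False q(2) assms(2) unfolding m_def by presburger+
    have "card (nth vs ` blocks k m) \<le> k + 1"
      using card_blocks[of k m] card_image_le[OF finite_blocks, of "nth vs" k m] by linarith
    then show ?thesis
      using dset_blocks[OF assms(1,2) m] q(1) by (intro dom_leI) auto
  qed
qed

lemma spanning_path_dom_le:
  assumes "spanning_path G vs" "length vs = 3 * k + 2"
  shows "dom_le G {} (k + 1)"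
proof -
  \<comment> \<open>The unsubdivided path is obtained from the one with its first edge subdivided:
    \<open>vs ! 0\<close> goes back in for the new vertex.\<close>
  let ?e = "{vs ! 0, vs ! Suc 0}" and ?A = "nth vs ` blocks k 0"
  have D: "dset G {?e} (nth vs ` (blocks k 0 - {0})) {?e}"
    using dset_blocks_gap[OF assms, of 0 0] by simp
  have 0: "vs ! 0 \<in> ?A" "?e \<in> edges G" "vs ! 0 \<in> vertices G"
    using assms by (auto simp: blocks_def spanning_path_def path_edges_def)
  have sub: "nth vs ` (blocks k 0 - {0}) \<subseteq> ?A" "?A \<subseteq> insert (vs ! 0) (nth vs ` (blocks k 0 - {0}))"
    by auto
  have "dset G {} ?A {}"
    unfolding dset_def
  proof (intro conjI ballI disjI1)
    show "?A \<subseteq> vertices G" using D 0(3) sub(2) unfolding dset_def by blast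
    fix v assume v: "v \<in> vertices G - ?A"
    then consider u where "u \<in> ?A" "{u, v} \<in> edges G" | "v \<in> ?e"
    proof -
      have "v \<in> vertices G" "v \<notin> nth vs ` (blocks k 0 - {0})" using v sub(1) by auto
      from dset_dominated[OF D this] show thesis
      proof (elim disjE bexE)
        fix u assume "u \<in> nth vs ` (blocks k 0 - {0})" "{u, v} \<in> edges G - {?e}"
        then show thesis using sub(1) by (intro that(1)) auto
      next
        fix e assume "e \<in> {?e}" "v \<in> e"
        then show thesis by (intro that(2)) simp
      qed
    qed
    then show "\<exists>u\<in>?A. {u, v} \<in> edges G - {}"
    proof cases
      case 2
      moreover have "v \<noteq> vs ! 0" using v 0(1) by (metis DiffD2)
      ultimately have "v = vs ! Suc 0" by simp
      then show ?thesis using 0(1,2) by (intro bexI[of _ "vs ! 0"]) simp_all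
    qed auto
  qed auto
  moreover have "card (nth vs ` blocks k 0) \<le> k + 1"
    using card_blocks[of k 0] card_image_le[OF finite_blocks, of "nth vs" k 0] by linarith
  ultimately show ?thesis by (intro dom_leI) auto
qed

section \<open>Lower bounds for dominating sets of paths\<close>

lemma card_cover_le:
  fixes I S :: "nat set"
  assumes "finite I" "\<And>j. j \<in> S \<Longrightarrow> j \<in> I \<or> Suc j \<in> I \<or> 0 < j \<and> j - 1 \<in> I"
  shows "card S \<le> 3 * card I"
proof -
  have "S \<subseteq> I \<union> Suc ` I \<union> (\<lambda>j. j - 1) ` I"
  proof
    fix j assume "j \<in> S"
    then consider "j \<in> I" | "Suc j \<in> I" | "0 < j" "j - 1 \<in> I" using assms(2) by blast
    then show "j \<in> I \<union> Suc ` I \<union> (\<lambda>j. j - 1) ` I" by cases (auto intro: rev_image_eqI)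
  qed
  then have "card S \<le> card (I \<union> Suc ` I \<union> (\<lambda>j. j - 1) ` I)"
    using assms(1) by (intro card_mono) auto
  also have "\<dots> \<le> card I + card (Suc ` I) + card ((\<lambda>j. j - 1) ` I)"
    by (meson add_le_mono1 card_Un_le le_trans)
  also have "\<dots> \<le> 3 * card I"
    using card_image_le[OF assms(1), of Suc] card_image_le[OF assms(1), of "\<lambda>j. j - 1"] by simp
  finally show ?thesis .
qed

lemma dset_index_cover:
  assumes "spanning_path G vs" "dset G {} A {}" "j < length vs"
    and "I = {i. i < length vs \<and> vs ! i \<in> A}"
  shows "j \<in> I \<or> Suc j \<in> I \<or> 0 < j \<and> j - 1 \<in> I"
proof (cases "vs ! j \<in> A")
  case False
  have d: "distinct vs" "set vs = vertices G" "edges G = path_edges vs"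
    using assms(1) by (auto simp: spanning_path_def)
  have "vs ! j \<in> vertices G" using d assms(3) by auto
  then obtain u where u: "u \<in> A" "{u, vs ! j} \<in> edges G"
    using False assms(2) unfolding dset_def by auto
  then have "u \<in> set vs" using assms(2) d(2) by (auto simp: dset_def)
  then obtain i where i: "i < length vs" "u = vs ! i" by (metis in_set_conv_nth)
  then have "j = Suc i \<or> i = Suc j" using nth_edge_iff[OF d(1) i(1) assms(3)] u(2) d(3) by simp
  then show ?thesis using i u(1) assms(4) by auto
qed (use assms in auto)

text \<open>Position \<open>3 * m + 2\<close> splits the path badly. It does not reach the
  \<open>3 * m + 1\<close> positions up to \<open>3 * m\<close>, which need \<open>m + 1\<close>
  others, nor the \<open>3 * (k - m) - 2\<close> positions from \<open>3 * m + 4\<close> on, which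
  need \<open>k - m\<close>. Rounding up on both sides costs the extra vertex.\<close>

lemma card_dset_ge_interior:
  assumes G: "spanning_path G vs" and len: "length vs = 3 * k + 2" and A: "dset G {} A {}"
    and m: "m < k" "vs ! (3 * m + 2) \<in> A"
  shows "k + 2 \<le> card A"
proof -
  define I where "I = {i. i < length vs \<and> vs ! i \<in> A}"
  have fI: "finite I" by (simp add: I_def)
  have cover: "j \<in> I \<or> Suc j \<in> I \<or> 0 < j \<and> j - 1 \<in> I" if "j < 3 * k + 2" for j
    using dset_index_cover[OF G A _ I_def] that len by simp
  let ?L = "I \<inter> {..<3 * m + 2}" and ?R = "I \<inter> {3 * m + 3..}"
  have "card {..3 * m} \<le> 3 * card ?L"
  proof (rule card_cover_le)
    show "j \<in> ?L \<or> Suc j \<in> ?L \<or> 0 < j \<and> j - 1 \<in> ?L" if "j \<in> {..3 * m}" for j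
      using cover[of j] that m(1) by auto
  qed (simp add: fI)
  moreover have "card {3 * m + 4..<3 * k + 2} \<le> 3 * card ?R"
  proof (rule card_cover_le)
    show "j \<in> ?R \<or> Suc j \<in> ?R \<or> 0 < j \<and> j - 1 \<in> ?R" if "j \<in> {3 * m + 4..<3 * k + 2}" for j
      using cover[of j] that m(1) by auto
  qed (simp add: fI)
  ultimately have LR: "m + 1 \<le> card ?L" "k - m \<le> card ?R" by auto
  have "card (?L \<union> ?R \<union> {3 * m + 2}) = card (?L \<union> ?R) + 1"
    using fI by (subst card_Un_disjoint) auto
  also have "card (?L \<union> ?R) = card ?L + card ?R"
    using fI by (subst card_Un_disjoint) auto
  finally have "k + 2 \<le> card (?L \<union> ?R \<union> {3 * m + 2})" using LR m by simp
  also have "\<dots> \<le> card I"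
    using fI m len by (intro card_mono) (auto simp: I_def)
  also have "card I = card (nth vs ` I)"
    using G by (intro card_image[symmetric] inj_on_nth) (auto simp: spanning_path_def I_def)
  also have "\<dots> \<le> card A"
  proof (rule card_mono)
    have "A \<subseteq> set vs" using A G by (auto simp: dset_def spanning_path_def)
    then show "finite A" using finite_subset by blast
  qed (auto simp: I_def)
  finally show ?thesis .
qed

text \<open>New vertices have degree two and old ones keep their degree, so closed neighbourhoods in
  the subdivided graph have at most three elements; those of the chosen vertices cover
  everything.\<close>

lemma card_le_if_degree_le_2:
  assumes G: "simple_graph G" and F: "F \<subseteq> edges G" and AX: "dset G F A X"
    and deg: "\<And>u. u \<in> vertices G \<Longrightarrow> card {g \<in> edges G. u \<in> g} \<le> 2"
  shows "card (vertices G) + card F \<le> 3 * (card A + card X)"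
proof -
  have fV: "finite (vertices G)" using G by (simp add: simple_graph_def)
  have fE: "finite (edges G)"
    using G by (rule finite_edges)
  have fA: "finite A" and fX: "finite X" and fF: "finite F"
    using AX F fV fE unfolding dset_def by (meson finite_subset)+
  \<comment> \<open>\<open>N\<close> and \<open>M\<close> are the closed neighbourhoods of old and
    new vertices; \<open>the_elem (g - {u})\<close> is the other end of \<open>g\<close>.\<close>
  define N where "N u = insert (Inl u)
    ((\<lambda>g. if g \<in> F then Inr g else Inl (the_elem (g - {u}))) ` {g \<in> edges G. u \<in> g})" for u
  define M where "M e = insert (Inr e) (Inl ` e)" for e :: "'a set"
  have N: "card (N u) \<le> 3" if "u \<in> A" for u
  proof -
    let ?f = "\<lambda>g. if g \<in> F then Inr g else Inl (the_elem (g - {u}))"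
    have "finite (?f ` {g \<in> edges G. u \<in> g})" using fE by (intro finite_imageI) simp
    then have "card (N u) \<le> Suc (card (?f ` {g \<in> edges G. u \<in> g}))"
      unfolding N_def by (simp only: card_insert_if split: if_split) linarith
    also have "\<dots> \<le> Suc (card {g \<in> edges G. u \<in> g})"
      using fE by (simp only: Suc_le_mono) (intro card_image_le, simp)
    also have "\<dots> \<le> 3"
      using deg[of u] that AX by (auto simp: dset_def)
    finally show ?thesis .
  qed
  have eX: "finite e \<and> card e = 2" if "e \<in> X" for e
  proof -
    have "e \<in> edges G" using that AX F by (auto simp: dset_def)
    then have "card e = 2" using G by (simp add: simple_graph_def)
    then show ?thesis by (metis card.infinite zero_neq_numeral)
  qed
  have M: "card (M e) \<le> 3" if "e \<in> X" for e
  proof -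
    have "finite e" "card e = 2" using eX[OF that] by auto
    then have "card (Inl ` e :: ('a + 'a set) set) \<le> 2" using card_image_le by metis
    then show ?thesis unfolding M_def using \<open>finite e\<close> by (simp add: card_insert_if)
  qed
  have "vertices G <+> F \<subseteq> (\<Union>u\<in>A. N u) \<union> (\<Union>e\<in>X. M e)"
  proof
    fix x assume "x \<in> vertices G <+> F"
    then consider v where "x = Inl v" "v \<in> vertices G" | e where "x = Inr e" "e \<in> F" by auto
    then show "x \<in> (\<Union>u\<in>A. N u) \<union> (\<Union>e\<in>X. M e)"
    proof cases
      case (1 v)
      show ?thesis
      proof (cases "v \<in> A")
        case True
        then show ?thesis using 1 by (auto simp: N_def)
      next
        case False
        then consider u where "u \<in> A" "{u, v} \<in> edges G - F" | e where "e \<in> X" "v \<in> e"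
          using dset_dominated[OF AX 1(2)] by auto
        then show ?thesis
        proof cases
          case (1 u)
          then have "u \<noteq> v" using False by auto
          then have "{u, v} - {u} = {v}" by auto
          then have "Inl v \<in> N u"
            using 1 unfolding N_def by (intro insertI2 image_eqI[of _ _ "{u, v}"]) simp_all
          then show ?thesis using 1(1) \<open>x = Inl v\<close> by (intro UnI1 UN_I[of u]) simp_all
        next
          case (2 e)
          then have "Inl v \<in> M e" by (simp add: M_def)
          then show ?thesis using 2(1) \<open>x = Inl v\<close> by (intro UnI2 UN_I[of e]) simp_all
        qed
      qed
    next
      case (2 e)
      show ?thesis
      proof (cases "e \<in> X")
        case True
        then show ?thesis using 2(1) by (intro UnI2 UN_I[of e]) (simp_all add: M_def)
      next
        case False
        then obtain u where u: "u \<in> A" "u \<in> e" using dset_touched[OF AX 2(2)] by auto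
        then have "Inr e \<in> N u"
          using 2(2) F unfolding N_def by (intro insertI2 image_eqI[of _ _ e]) auto
        then show ?thesis using u(1) 2(1) by (intro UnI1 UN_I[of u]) simp_all
      qed
    qed
  qed
  then have "card (vertices G <+> F) \<le> card ((\<Union>u\<in>A. N u) \<union> (\<Union>e\<in>X. M e))"
  proof (rule card_mono[rotated])
    show "finite ((\<Union>u\<in>A. N u) \<union> (\<Union>e\<in>X. M e))"
      using fA fX fE eX by (auto simp: N_def M_def)
  qed
  also have "\<dots> \<le> card (\<Union>u\<in>A. N u) + card (\<Union>e\<in>X. M e)"
    by (rule card_Un_le)
  also have "\<dots> \<le> (\<Sum>u\<in>A. card (N u)) + (\<Sum>e\<in>X. card (M e))"
    using fA fX by (intro add_mono card_UN_le)
  also have "\<dots> \<le> (\<Sum>u\<in>A. 3) + (\<Sum>e\<in>X. 3)"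
    using N M by (intro add_mono sum_mono)
  finally show ?thesis using fV fF by (simp add: card_Plus)
qed

lemma spanning_path_degree:
  assumes "spanning_path G vs"
  shows "card {g \<in> edges G. u \<in> g} \<le> 2"
proof (cases "u \<in> set vs")
  case True
  then obtain i where i: "i < length vs" "u = vs ! i" by (metis in_set_conv_nth)
  have d: "distinct vs" "edges G = path_edges vs"
    using assms by (auto simp: spanning_path_def)
  \<comment> \<open>At an end of the path one of the two sets is no edge, which an upper bound
    tolerates.\<close>
  have "{g \<in> edges G. u \<in> g} \<subseteq> {{vs ! i, vs ! Suc i}, {vs ! (i - 1), vs ! i}}"
  proof
    fix g assume "g \<in> {g \<in> edges G. u \<in> g}"
    then obtain q where q: "g = {vs ! q, vs ! Suc q}" "Suc q < length vs" "u \<in> g"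
      using d by (auto simp: path_edges_def)
    then have "i = q \<or> i = Suc q"
      using i d(1) by (auto simp: nth_eq_iff_index_eq)
    then show "g \<in> {{vs ! i, vs ! Suc i}, {vs ! (i - 1), vs ! i}}" using q(1) by auto
  qed
  then have "card {g \<in> edges G. u \<in> g} \<le> card {{vs ! i, vs ! Suc i}, {vs ! (i - 1), vs ! i}}"
    by (intro card_mono) auto
  also have "\<dots> \<le> 2" by (simp add: card_insert_if)
  finally show ?thesis .
next
  case False
  have "{g \<in> edges G. u \<in> g} = {}"
    using False assms unfolding spanning_path_def path_edges_def by auto
  then show ?thesis by (simp only: card.empty)
qed

lemma spanning_path_dom_le_lower:
  assumes "spanning_path G vs" "length vs = 3 * k + 2" "F \<subseteq> edges G" "dom_le G F n"
  shows "3 * k + 2 + card F \<le> 3 * n"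
proof -
  obtain A X where AX: "dset G F A X" "card A + card X \<le> n"
    using assms(4) by (rule dom_leE)
  have "card (vertices G) = 3 * k + 2"
    using assms(1,2) unfolding spanning_path_def by (metis distinct_card)
  then have "3 * k + 2 + card F \<le> 3 * (card A + card X)"
    using card_le_if_degree_le_2[OF spanning_path_simple[OF assms(1)] assms(3) AX(1)
        spanning_path_degree[OF assms(1)]] by simp
  also have "\<dots> \<le> 3 * n" using AX(2) by (rule mult_le_mono2)
  finally show ?thesis .
qed

lemma spanning_path_tight:
  assumes "spanning_path G vs" "length vs = 3 * k + 2"
  shows "tight G (k + 1)"
  unfolding tight_def
proof (intro conjI allI impI ballI)
  show "dom_le G {} (k + 1)" using assms by (rule spanning_path_dom_le)
  show "\<not> dom_le G {} m" if "m < k + 1" for m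
    using spanning_path_dom_le_lower[OF assms, of "{}" m] that by auto
  show "dom_le G {e} (k + 1)" if "e \<in> edges G" for e
    using assms that by (rule spanning_path_dom_le_edge)
  show "\<not> dom_le G {e, f} (k + 1)" if "e \<in> edges G" "f \<in> edges G" "e \<noteq> f" for e f
    using spanning_path_dom_le_lower[OF assms, of "{e, f}" "k + 1"] that by auto
qed

section \<open>Tight trees\<close>

context pendant
begin

text \<open>A walk can leave \<open>Q\<close> and return only through \<open>p\<close>. Reading
  \<open>p\<close> for each of \<open>a\<close>, \<open>s\<close>, \<open>t\<close> turns a walk in
  \<open>G\<close> into a walk in \<open>Q\<close>.\<close>

lemma connected_Q:
  assumes "connected_graph G"
  shows "connected_graph Q"
proof -
  have adjQ: "adj Q u v" if "adj G u v" "u \<notin> {a, s, t}" "v \<notin> {a, s, t}" for u v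
    using that by (auto simp: adj_def EQ)
  have nb: "v \<in> nbrs G u \<and> u \<in> nbrs G v" if "adj G u v" for u v
    using that nbrs_sym by (fastforce simp: adj_def nbrs_def)
  have "(adj Q)\<^sup>*\<^sup>* u (if v \<in> {a, s, t} then p else v)" if "(adj G)\<^sup>*\<^sup>* u v" "u \<notin> {a, s, t}" for u v
    using that
  proof (induction rule: rtranclp_induct)
    case (step v w)
    note IH = step.IH[OF step.prems]
    show ?case
    proof (cases "v \<in> {a, s, t}")
      case True
      then have "w \<in> {a, s, t} \<or> w = p" using nb[OF step.hyps(2)] a s t by auto
      then show ?thesis using IH True by auto
    next
      case v: False
      show ?thesis
      proof (cases "w \<in> {a, s, t}")
        case True
        then have "v = p" using v nb[OF step.hyps(2)] a s t by auto
        then show ?thesis using IH v True by simp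
      next
        case False
        then have "adj Q v w" using adjQ step.hyps(2) v by blast
        then show ?thesis using IH v False by (simp add: rtranclp.rtrancl_into_rtrancl)
      qed
    qed
  qed simp
  note reach = this
  have "(adj Q)\<^sup>*\<^sup>* u v" if "u \<in> vertices Q" "v \<in> vertices Q" for u v
    using reach[of u v] that assms unfolding connected_graph_def VQ by auto
  then show ?thesis using p_Q unfolding connected_graph_def by blast
qed

lemma tree_Q:
  assumes "tree G"
  shows "tree Q"
proof -
  have "adj Q u v \<Longrightarrow> adj G u v" for u v by (simp add: adj_def EQ)
  then have "cycle Q vs \<Longrightarrow> cycle G vs" for vs
    unfolding cycle_def by (metis successively_mono)
  then show ?thesis using assms simple_Q connected_Q unfolding tree_def by blast
qed

text \<open>A position \<open>3 * m\<close> with \<open>m \<ge> 1\<close> has an edge to its left.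
  The set from \<open>blocks k m\<close> contains \<open>p\<close> and survives the subdivision of
  that edge, and a chosen \<open>p\<close> makes the subdivision of \<open>st\<close> free as
  well.\<close>

lemma endpoint_if_mod_0:
  assumes G: "tight G n" and vs: "spanning_path Q vs" "length vs = 3 * k + 2"
    and i: "i < length vs" "vs ! i = p" "i mod 3 = 0"
  shows "i = 0"
proof (rule ccontr)
  assume "i \<noteq> 0"
  define m where "m = i div 3"
  have m: "i = 3 * m" "1 \<le> m" "m \<le> k" using i \<open>i \<noteq> 0\<close> vs(2) unfolding m_def by presburger+
  let ?e = "{vs ! (i - 1), vs ! Suc (i - 1)}" and ?A = "nth vs ` blocks k m"
  have D: "dset Q {?e} ?A {}"
    by (rule dset_blocks[OF vs m(2,3)]) (simp add: m(1))
  have e: "?e \<in> edges Q"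
    using vs i \<open>i \<noteq> 0\<close> unfolding spanning_path_def path_edges_def by auto
  have "i \<in> blocks k m" using m by (simp add: blocks_iff)
  then have "p \<in> ?A" using i(2) by blast
  then have "dset G {{s, t}, ?e} (insert s ?A) {}"
    using dset_insert_st[OF D] e by simp
  moreover have "card (insert s ?A) \<le> n"
  proof -
    obtain l where l: "n = Suc l" "tight Q l" using tight_strip[OF G] .
    then have "k + 1 \<le> l"
      using spanning_path_dom_le_lower[OF vs _ tight_dom_le[OF l(2)]] by simp
    moreover have "card ?A \<le> k + 1"
      using card_blocks[of k m] card_image_le[OF finite_blocks, of "nth vs" k m] by linarith
    moreover have "card (insert s ?A) \<le> Suc (card ?A)"
      using finite_blocks by (simp add: card_insert_if)
    ultimately show ?thesis using l by linarith
  qed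
  ultimately have "dom_le G {{s, t}, ?e} n" by (intro dom_leI) auto
  moreover have "{s, t} \<noteq> ?e" using e by (auto simp: EQ)
  moreover have "{s, t} \<in> edges G" "?e \<in> edges G" using e by (simp_all add: edges_G)
  ultimately show False using tight_not_dom_le_pair[OF G] by metis
qed

text \<open>Subdividing \<open>tp\<close> at no cost would put \<open>p\<close> into a dominating
  set of \<open>Q\<close> with at most \<open>k + 1\<close> vertices, which such a position does not
  allow.\<close>

lemma index_mod_3_neq_2:
  assumes G: "tight G n" and vs: "spanning_path Q vs" "length vs = 3 * k + 2"
    and i: "i < length vs" "vs ! i = p"
  shows "i mod 3 \<noteq> 2"
proof
  assume "i mod 3 = 2"
  define m where "m = i div 3"
  have m: "i = 3 * m + 2" "m < k" using i(1) vs(2) \<open>i mod 3 = 2\<close> unfolding m_def by presburger+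
  obtain l where l: "n = Suc l" "tight Q l" using tight_strip[OF G] .
  have "{t, p} \<in> edges G" by (simp add: edges_G)
  then have "dom_le G {{t, p}} n" by (rule tight_dom_le_edge[OF G])
  then obtain A where A: "dset Q {} A {}" "p \<in> A" "card A < n"
    using dset_strip_tp by blast
  have "k + 2 \<le> card A"
    using card_dset_ge_interior[OF vs A(1) m(2)] A(2) i(2) m(1) by simp
  moreover have "l \<le> k + 1"
    using tight_not_dom_le_less[OF l(2)] spanning_path_dom_le[OF vs] by (meson not_le)
  ultimately show False using A(3) l(1) by linarith
qed

lemma spanning_path_extend:
  assumes G: "tight G n" and vs: "spanning_path Q vs" "length vs = 3 * k + 2"
  shows "\<exists>ws. spanning_path G ws \<and> length ws = 3 * (k + 1) + 2"
proof -
  have *: ?thesis if ws: "spanning_path Q ws" "length ws = 3 * k + 2" "ws ! 0 = p" for ws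
  proof -
    obtain us where us: "ws = p # us" using ws(2,3) by (cases ws) auto
    have "spanning_path G (a # s # t # ws)"
      using ws(1) V ne unfolding spanning_path_def us edges_G VQ by auto
    then show ?thesis using ws(2) by (intro exI[of _ "a # s # t # ws"]) simp
  qed
  have "p \<in> set vs" using vs(1) p_Q by (simp add: spanning_path_def)
  then obtain i where i: "i < length vs" "vs ! i = p" by (metis in_set_conv_nth)
  have rev: "spanning_path Q (rev vs)" "length (rev vs) = 3 * k + 2"
    using vs spanning_path_rev by auto
  \<comment> \<open>Reversal exchanges the residues 0 and 1 and keeps 2.\<close>
  let ?j = "3 * k + 1 - i"
  have j: "?j < length (rev vs)" "rev vs ! ?j = p" using i vs(2) by (auto simp: rev_nth)
  consider "i mod 3 = 0" | "i mod 3 = 1" | "i mod 3 = 2" by linarith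
  then show ?thesis
  proof cases
    case 1
    then show ?thesis using *[OF vs] endpoint_if_mod_0[OF G vs i] i(2) by auto
  next
    case 2
    then have "?j mod 3 = 0" using i(1) vs(2) by presburger
    then show ?thesis using *[OF rev] endpoint_if_mod_0[OF G rev j] j(2) by auto
  next
    case 3
    then show ?thesis using index_mod_3_neq_2[OF G vs i] by simp
  qed
qed

end

section \<open>Longest paths in tight trees\<close>

definition path :: "'a sgraph \<Rightarrow> 'a list \<Rightarrow> bool" where
  "path G vs \<longleftrightarrow> distinct vs \<and> set vs \<subseteq> vertices G \<and> successively (adj G) vs"

definition longest_path :: "'a sgraph \<Rightarrow> 'a list \<Rightarrow> bool" where
  "longest_path G vs \<longleftrightarrow> path G vs \<and> (\<forall>ws. path G ws \<longrightarrow> length ws \<le> length vs)"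

lemma adj_iff_nbrs: "adj G u v \<longleftrightarrow> v \<in> nbrs G u"
  by (simp add: adj_def nbrs_def)

lemma adj_sym: "adj G u v \<Longrightarrow> adj G v u"
  by (simp add: adj_def insert_commute)

lemma path_Cons:
  assumes "simple_graph G" "path G (y # r)" "adj G x y" "x \<notin> set (y # r)"
  shows "path G (x # y # r)"
  using assms nbrs_vertices[OF assms(1), of y x] by (auto simp: path_def adj_iff_nbrs)

lemma path_ConsD: "path G (x # r) \<Longrightarrow> path G r"
  by (auto simp: path_def successively_Cons)

lemma path_rev: "path G vs \<Longrightarrow> path G (rev vs)"
  unfolding path_def by (auto intro: successively_mono adj_sym)

lemma longest_path_rev: "longest_path G vs \<Longrightarrow> longest_path G (rev vs)"
  by (auto simp: longest_path_def path_rev)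

text \<open>A neighbour of the head further along would close a cycle with the segment leading to
  it.\<close>

lemma tree_hd_nbr:
  assumes "tree G" "path G (x # y # r)" "adj G x z" "z \<in> set (x # y # r)"
  shows "z = y"
proof (rule ccontr)
  assume "z \<noteq> y"
  moreover have "z \<noteq> x"
    using assms(1,3) nbrs_vertices[of G z x] by (auto simp: tree_def adj_iff_nbrs)
  ultimately have "z \<in> set r" using assms(4) by auto
  then obtain us ws where r: "r = us @ z # ws" by (meson split_list)
  have "cycle G (x # y # us @ [z])"
    using assms(2) adj_sym[OF assms(3)] unfolding cycle_def path_def r
    by (auto simp: successively_Cons successively_append_iff hd_append split: if_splits)
  then show False using assms(1) by (auto simp: tree_def)
qed

lemma longest_path_hd_nbrs:
  assumes "tree G" "longest_path G (x # y # r)"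
  shows "nbrs G x = {y}"
proof -
  have G: "simple_graph G" using assms(1) by (simp add: tree_def)
  have P: "path G (x # y # r)" using assms(2) by (simp add: longest_path_def)
  have "z = y" if z: "z \<in> nbrs G x" for z
  proof (cases "z \<in> set (x # y # r)")
    case True
    then show ?thesis using tree_hd_nbr[OF assms(1) P] z by (simp add: adj_iff_nbrs)
  next
    case False
    then have "path G (z # x # y # r)"
      using path_Cons[OF G P] z by (simp add: adj_iff_nbrs nbrs_sym)
    then show ?thesis using assms(2) by (auto simp: longest_path_def)
  qed
  moreover have "y \<in> nbrs G x" using P by (simp add: path_def adj_iff_nbrs)
  ultimately show ?thesis by blast
qed

text \<open>Makes every neighbour of \<open>s\<close> except \<open>t\<close> the end of a longest
  path, hence a leaf.\<close>

lemma longest_path_change_hd: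
  assumes "tree G" "longest_path G (a # s # t # r)" "b \<in> nbrs G s" "b \<noteq> t"
  shows "longest_path G (b # s # t # r)"
proof -
  have P: "path G (s # t # r)" using assms(2) path_ConsD by (auto simp: longest_path_def)
  have "b \<notin> set (s # t # r)"
    using tree_hd_nbr[OF assms(1) P, of b] assms(3,4) by (auto simp: adj_iff_nbrs)
  then have "path G (b # s # t # r)"
    using path_Cons[OF _ P, of b] assms(1,3) by (simp add: tree_def adj_iff_nbrs nbrs_sym)
  then show ?thesis using assms(2) by (simp add: longest_path_def)
qed

lemma tight_no_two_leaves:
  assumes "simple_graph G" "tight G n" "nbrs G a = {s}" "nbrs G b = {s}"
  shows "a = b"
proof (rule ccontr)
  assume "a \<noteq> b"
  have "{a, s} \<in> edges G" using assms(3) by (simp add: edge_iff_nbrs)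
  then have "dom_le G {{a, s}} n" by (rule tight_dom_le_edge[OF assms(2)])
  then show False
    using dom_le_two_leaves[OF assms(1,3,4) \<open>a \<noteq> b\<close>] tight_not_dom_le_less[OF assms(2)] by metis
qed

lemma tight_longest_path_support:
  assumes "tree G" "tight G n" "longest_path G (a # s # t # r)"
  shows "nbrs G s = {a, t}"
proof -
  have "simple_graph G" using assms(1) by (simp add: tree_def)
  have "b = a" if "b \<in> nbrs G s" "b \<noteq> t" for b
    using tight_no_two_leaves[OF \<open>simple_graph G\<close> assms(2)]
      longest_path_hd_nbrs[OF assms(1) assms(3)]
      longest_path_hd_nbrs[OF assms(1) longest_path_change_hd[OF assms(1,3) that]] by blast
  moreover have "a \<in> nbrs G s" "t \<in> nbrs G s"
    using assms(3) by (auto simp: longest_path_def path_def adj_iff_nbrs nbrs_sym)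
  ultimately show ?thesis by blast
qed

text \<open>The second conclusion keeps the induction alive: \<open>p\<close> has a neighbour beyond
  \<open>t\<close>, so the rest has at least two vertices.\<close>

lemma tight_longest_path_third:
  assumes G: "tree G" and n: "tight G n" and L: "longest_path G (a # s # t # p # r)"
  shows "nbrs G t = {s, p}" "nbrs G p \<noteq> {t}"
proof -
  have sG: "simple_graph G" using G by (simp add: tree_def)
  have P: "path G (a # s # t # p # r)" using L by (simp add: longest_path_def)
  note a = longest_path_hd_nbrs[OF G L] and s = tight_longest_path_support[OF G n L]
  have d: "a \<noteq> t" "s \<noteq> p" "s \<noteq> t" using P by (auto simp: path_def)
  have tsp: "s \<in> nbrs G t" "p \<in> nbrs G t"
    using P by (auto simp: path_def adj_iff_nbrs nbrs_sym)
  have as: "{a, s} \<in> edges G" "{s, t} \<in> edges G" "{t, p} \<in> edges G" "{a, s} \<noteq> {s, t}"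
    using a s tsp d by (auto simp: edge_iff_nbrs doubleton_eq_iff)
  have no_leaf: "nbrs G b \<noteq> {t}" if "b \<noteq> s" for b
  proof
    assume "nbrs G b = {t}"
    then have "dom_le G {{a, s}, {s, t}} n"
      by (rule dom_le_leaf_at[OF sG a s _ that[symmetric] d(1) tight_dom_le[OF n]])
    then show False using tight_not_dom_le_pair[OF n as(1,2,4)] by contradiction
  qed
  show "nbrs G p \<noteq> {t}" using no_leaf[OF d(2)[symmetric]] .
  have "c = p" if c: "c \<in> nbrs G t" "c \<noteq> s" for c
  proof (rule ccontr)
    assume "c \<noteq> p"
    have Pt: "path G (t # p # r)" using P by (blast dest: path_ConsD)
    have "c \<notin> set (t # p # r)"
      using tree_hd_nbr[OF G Pt, of c] c \<open>c \<noteq> p\<close> by (auto simp: adj_iff_nbrs)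
    then have Pc: "path G (c # t # p # r)"
      using path_Cons[OF sG Pt, of c] c by (simp add: adj_iff_nbrs nbrs_sym)
    have "t \<in> nbrs G c" using c by (simp add: nbrs_sym)
    then obtain d where d': "d \<in> nbrs G c" "d \<noteq> t" using no_leaf[OF c(2)] by blast
    then have "d \<notin> set (c # t # p # r)"
      using tree_hd_nbr[OF G Pc, of d] by (auto simp: adj_iff_nbrs)
    then have "path G (d # c # t # p # r)"
      using path_Cons[OF sG Pc, of d] d' by (simp add: adj_iff_nbrs nbrs_sym)
    \<comment> \<open>A path of the same length, so \<open>d\<close> is a leaf and \<open>c\<close>
      has degree two: a second pendant path at \<open>t\<close>. Then \<open>as\<close> can be
      subdivided for free in addition to \<open>tp\<close>.\<close>
    then have L': "longest_path G (d # c # t # p # r)" using L by (simp add: longest_path_def)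
    have "{t, p} \<notin> {{a, s}, {s, t}, {t, c}, {c, d}}"
      using d d' \<open>c \<noteq> p\<close> \<open>d \<notin> set (c # t # p # r)\<close>
      by (simp add: doubleton_eq_iff) blast
    then have "dom_le G {{t, p}, {a, s}} n"
      using d(1) d'(2) c(2)
      by (intro dom_le_two_pendant_paths[OF sG a s longest_path_hd_nbrs[OF G L']
            tight_longest_path_support[OF G n L'] _ _ _ as(3) _ tight_dom_le_edge[OF n as(3)]])
        simp_all
    moreover have "{t, p} \<noteq> {a, s}" using d by (simp add: doubleton_eq_iff)
    ultimately show False using tight_not_dom_le_pair[OF n as(3,1)] by simp
  qed
  then show "nbrs G t = {s, p}" using tsp by blast
qed

lemma connected_closed:
  assumes "connected_graph G" "u \<in> vertices G" "u \<in> S" "\<And>x. x \<in> S \<Longrightarrow> nbrs G x \<subseteq> S"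
  shows "vertices G \<subseteq> S"
proof
  fix v assume "v \<in> vertices G"
  then have "(adj G)\<^sup>*\<^sup>* u v" using assms(1,2) by (simp add: connected_graph_def)
  then show "v \<in> S"
    by (induction rule: rtranclp_induct) (use assms(3,4) in \<open>auto simp: adj_iff_nbrs\<close>)
qed

lemma longest_path_exists:
  assumes "finite (vertices G)"
  shows "\<exists>vs. longest_path G vs"
proof -
  have "length vs < Suc (card (vertices G))" if "path G vs" for vs
    using that assms unfolding path_def by (metis card_mono distinct_card less_Suc_eq_le)
  moreover have "path G []" by (simp add: path_def)
  ultimately show ?thesis
    using ex_has_greatest_nat[of "path G" "[]" length "Suc (card (vertices G))"]
    unfolding longest_path_def by blast
qed

lemma longest_path_length_ge_2:
  assumes "simple_graph G" "connected_graph G" "2 \<le> card (vertices G)" "longest_path G vs"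
  shows "2 \<le> length vs"
proof -
  obtain u where u: "u \<in> vertices G" using assms(2) by (auto simp: connected_graph_def)
  have "\<not> vertices G \<subseteq> {u}" using assms(3) card_mono[of "{u}" "vertices G"] by auto
  then obtain v where v: "v \<in> nbrs G u" using connected_closed[OF assms(2) u, of "{u}"] by blast
  then have "path G [u, v]"
    using nbrs_vertices[OF assms(1) v] by (auto simp: path_def adj_iff_nbrs)
  then show ?thesis using assms(4) by (force simp: longest_path_def)
qed

text \<open>The bound is 2 because removing three vertices from the path on five leaves a single
  edge, which is tight and is the case \<open>k = 0\<close>.\<close>

lemma tree_tight_spanning_path:
  assumes "tree G" "2 \<le> card (vertices G)" "tight G n"
  shows "\<exists>k vs. spanning_path G vs \<and> length vs = 3 * k + 2"
  using assms
proof (induction "card (vertices G)" arbitrary: G n rule: less_induct)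
  case less
  have sG: "simple_graph G" and cG: "connected_graph G" using less.prems by (auto simp: tree_def)
  have fin: "finite (vertices G)" using sG by (simp add: simple_graph_def)
  obtain us where us: "longest_path G us" using longest_path_exists[OF fin] ..
  then have "2 \<le> length us" using longest_path_length_ge_2 sG cG less.prems(2) by blast
  then obtain a s us' where us': "us = a # s # us'" by (auto simp: numeral_2_eq_2 Suc_le_length_iff)
  consider "us' = []" | t where "us' = [t]" | t p r where "us' = t # p # r"
    by (metis list.exhaust)
  then show ?case
  proof cases
    case 1
    then have L: "longest_path G [a, s]" "longest_path G [s, a]"
      using us us' longest_path_rev[of G us] by auto
    have nb: "nbrs G a = {s}" "nbrs G s = {a}" using L longest_path_hd_nbrs[OF less.prems(1)] by auto
    have as: "a \<in> vertices G" "s \<in> vertices G" "a \<noteq> s" using nbrs_vertices[OF sG, of s a] nb by auto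
    have "vertices G \<subseteq> {a, s}" using connected_closed[OF cG as(1), of "{a, s}"] nb by auto
    then have V: "vertices G = {a, s}" using as by auto
    have "e = {a, s}" if "e \<in> edges G" for e
    proof (rule card_subset_eq)
      show "e \<subseteq> {a, s}" using that sG V by (auto simp: simple_graph_def)
      show "card e = card {a, s}" using that sG as by (simp add: simple_graph_def)
    qed simp
    moreover have "{a, s} \<in> edges G" using nb by (simp add: edge_iff_nbrs)
    ultimately have "edges G = {{a, s}}" by blast
    then have "spanning_path G [a, s]" using V as by (simp add: spanning_path_def)
    then show ?thesis by (intro exI[of _ 0] exI[of _ "[a, s]"]) simp
  next
    \<comment> \<open>Both ends of a longest path with three vertices are leaves at
      \<open>s\<close>, which tightness forbids.\<close>
    case (2 t)
    then have L: "longest_path G [a, s, t]" "longest_path G [t, s, a]"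
      using us us' longest_path_rev[of G us] by auto
    then have "a = t"
      using tight_no_two_leaves[OF sG less.prems(3)] longest_path_hd_nbrs[OF less.prems(1)] by blast
    then show ?thesis using L by (auto simp: longest_path_def path_def)
  next
    case (3 t p r)
    then have L: "longest_path G (a # s # t # p # r)" using us us' by simp
    then have "distinct (a # s # t # p # r)" by (simp add: longest_path_def path_def)
    then interpret pendant G a s t p
      using sG longest_path_hd_nbrs[OF less.prems(1) L]
        tight_longest_path_support[OF less.prems(1,3) L]
        tight_longest_path_third[OF less.prems(1,3) L] by unfold_locales auto
    obtain m where m: "tight Q m" using tight_strip[OF less.prems(3)] .
    have "t \<in> nbrs G p" using t by (simp add: nbrs_sym)
    then obtain q where q: "q \<in> nbrs G p" "q \<noteq> t"
      using tight_longest_path_third(2)[OF less.prems(1,3) L] by blast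
    then have "p \<in> nbrs G q" by (simp add: nbrs_sym)
    then have "q \<noteq> a" "q \<noteq> s" using a s ne V by auto
    then have "q \<in> vertices Q" "q \<noteq> p" using q nbrs_vertices[OF sG q(1)] by (auto simp: VQ)
    then have "card {p, q} \<le> card (vertices Q)"
      using p_Q fin by (intro card_mono) (auto simp: VQ)
    then have "2 \<le> card (vertices Q)" using \<open>q \<noteq> p\<close> by simp
    moreover have "card (vertices Q) < card (vertices G)"
      using fin V by (intro psubset_card_mono) (auto simp: VQ)
    ultimately obtain k vs where "spanning_path Q vs" "length vs = 3 * k + 2"
      using less.hyps[OF _ tree_Q[OF less.prems(1)] _ m] by blast
    then show ?thesis using spanning_path_extend[OF less.prems(3)] by blast
  qed
qed

section \<open>Isomorphism with \<open>path_graph\<close> and the equivalence\<close>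

lemma adj_path_graph: "adj (path_graph n) i j \<longleftrightarrow> i < n \<and> j < n \<and> (j = Suc i \<or> i = Suc j)"
  by (auto simp: adj_def path_graph_def doubleton_eq_iff)

lemma graph_iso_path_graph_iff:
  assumes "simple_graph G"
  shows "graph_iso G (path_graph n) \<longleftrightarrow> (\<exists>vs. spanning_path G vs \<and> length vs = n)"
proof
  assume "graph_iso G (path_graph n)"
  then obtain f where f: "bij_betw f (vertices G) {..<n}"
      "\<And>u v. u \<in> vertices G \<Longrightarrow> v \<in> vertices G \<Longrightarrow> adj G u v \<longleftrightarrow> adj (path_graph n) (f u) (f v)"
    by (auto simp: graph_iso_def path_graph_def)
  define g where "g = inv_into (vertices G) f"
  define vs where "vs = map g [0..<n]"
  have g: "bij_betw g {..<n} (vertices G)" unfolding g_def using f(1) by (rule bij_betw_inv_into)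
  have gf: "g (f u) = u" if "u \<in> vertices G" for u
    unfolding g_def using f(1) that by (simp add: bij_betw_def)
  have fg: "f (g i) = i" "g i \<in> vertices G" if "i < n" for i
    unfolding g_def using f(1) that bij_betw_inv_into_right[OF f(1)] bij_betwE[OF g] g_def by auto
  have fn: "f u < n" if "u \<in> vertices G" for u using f(1) that bij_betwE by blast
  have vs_nth: "vs ! i = g i" if "i < n" for i using that by (simp add: vs_def)
  have "distinct vs" "set vs = vertices G"
    using g by (auto simp: vs_def distinct_map bij_betw_def atLeast0LessThan)
  moreover have "edges G = path_edges vs"
  proof (intro equalityI subsetI)
    fix e assume e: "e \<in> edges G"
    obtain u v where uv: "e = {u, v}" "v \<in> nbrs G u" using assms e by (rule edgeE)
    then have V: "u \<in> vertices G" "v \<in> vertices G" using nbrs_vertices[OF assms] by auto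
    then have "f v = Suc (f u) \<or> f u = Suc (f v)"
      using f(2) uv(2) by (simp add: adj_iff_nbrs[symmetric] adj_path_graph)
    then show "e \<in> path_edges vs"
    proof
      assume "f v = Suc (f u)"
      then have "e = {vs ! f u, vs ! Suc (f u)}" "Suc (f u) < length vs"
        using uv(1) V gf fn vs_nth by (simp_all add: vs_def flip: \<open>f v = Suc (f u)\<close>)
      then show ?thesis unfolding path_edges_def by blast
    next
      assume "f u = Suc (f v)"
      then have "e = {vs ! f v, vs ! Suc (f v)}" "Suc (f v) < length vs"
        using uv(1) V gf fn vs_nth
        by (simp_all add: vs_def insert_commute flip: \<open>f u = Suc (f v)\<close>)
      then show ?thesis unfolding path_edges_def by blast
    qed
  next
    fix e assume "e \<in> path_edges vs"
    then obtain i where i: "e = {g i, g (Suc i)}" "Suc i < n"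
      by (auto simp: path_edges_def vs_def)
    then have "adj G (g i) (g (Suc i))" using f(2) fg by (simp add: adj_path_graph)
    then show "e \<in> edges G" using i(1) by (simp add: adj_def)
  qed
  ultimately show "\<exists>vs. spanning_path G vs \<and> length vs = n"
    by (intro exI[of _ vs]) (simp add: spanning_path_def vs_def)
next
  assume "\<exists>vs. spanning_path G vs \<and> length vs = n"
  then obtain vs where vs: "distinct vs" "set vs = vertices G" "edges G = path_edges vs" "length vs = n"
    by (auto simp: spanning_path_def)
  define f where "f = inv_into {..<n} (nth vs)"
  have b: "bij_betw (nth vs) {..<n} (vertices G)"
    using vs by (intro bij_betw_nth) auto
  have f: "bij_betw f (vertices G) {..<n}" unfolding f_def using b by (rule bij_betw_inv_into)
  have nf: "f u < n \<and> vs ! f u = u" if "u \<in> vertices G" for u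
    using f b that bij_betwE[OF f] bij_betw_inv_into_right[OF b] by (auto simp: f_def)
  have "adj G u v \<longleftrightarrow> adj (path_graph n) (f u) (f v)" if "u \<in> vertices G" "v \<in> vertices G" for u v
    using nth_edge_iff[OF vs(1), of "f u" "f v"] nf[OF that(1)] nf[OF that(2)] vs(3,4)
    unfolding adj_path_graph by (simp add: adj_def)
  then show "graph_iso G (path_graph n)"
    unfolding graph_iso_def using f by (intro exI[of _ f]) (simp add: path_graph_def)
qed

lemma two_edges_exist:
  assumes "simple_graph G" "connected_graph G" "3 \<le> card (vertices G)"
  obtains e f where "e \<in> edges G" "f \<in> edges G" "e \<noteq> f"
proof -
  have "vertices G \<noteq> {}" using assms(2) by (simp add: connected_graph_def)
  then obtain u where u: "u \<in> vertices G" by blast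
  have big: "\<not> vertices G \<subseteq> S" if "finite S" "card S \<le> 2" for S
    using card_mono[OF that(1), of "vertices G"] that(2) assms(3) by linarith
  obtain v where v: "v \<in> nbrs G u"
    using connected_closed[OF assms(2) u, of "{u}"] big[of "{u}"] by auto
  have "card {u, v} \<le> 2" by (simp add: card_insert_if)
  then obtain x y where xy: "x \<in> {u, v}" "y \<in> nbrs G x" "y \<notin> {u, v}"
    using connected_closed[OF assms(2) u, of "{u, v}"] big[of "{u, v}"] by blast
  then have "{u, v} \<noteq> {x, y}" by auto
  moreover have "{u, v} \<in> edges G" "{x, y} \<in> edges G" using v xy by (auto simp: edge_iff_nbrs)
  ultimately show thesis using that by blast
qed

lemma tight_domination_number:
  assumes "simple_graph G" "tight G n"
  shows "domination_number G = n"
proof (rule antisym)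
  show "domination_number G \<le> n"
    using assms domination_number_le_iff_dom_le by (auto simp: tight_def)
  have "dom_le G {} (domination_number G)"
    using domination_number_le_iff_dom_le[OF assms(1)] by blast
  then show "n \<le> domination_number G" using tight_not_dom_le_less[OF assms(2)] by (meson not_le)
qed

theorem theorem4p3:
  fixes T :: "'a sgraph"
  assumes "tree T" and "3 \<le> card (vertices T)"
  shows "critical 2 T \<and> domination_subdivision_number T = 2 \<longleftrightarrow>
         (\<exists>k\<ge>1. graph_iso T (path_graph (3 * k + 2)))"
proof -
  have T: "simple_graph T" "connected_graph T" using assms(1) by (auto simp: tree_def)
  obtain e f where ef: "e \<in> edges T" "f \<in> edges T" "e \<noteq> f"
    using two_edges_exist[OF T assms(2)] .
  have "critical 2 T \<and> domination_subdivision_number T = 2 \<longleftrightarrow> tight T (domination_number T)"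
    by (rule critical_sd_iff_tight[OF T assms(2) ef])
  also have "\<dots> \<longleftrightarrow> (\<exists>k vs. spanning_path T vs \<and> length vs = 3 * k + 2)"
  proof
    assume "tight T (domination_number T)"
    then show "\<exists>k vs. spanning_path T vs \<and> length vs = 3 * k + 2"
      using tree_tight_spanning_path[OF assms(1)] assms(2) by simp
  next
    assume "\<exists>k vs. spanning_path T vs \<and> length vs = 3 * k + 2"
    then obtain k where "tight T (k + 1)" using spanning_path_tight by blast
    then show "tight T (domination_number T)" using tight_domination_number[OF T(1)] by simp
  qed
  also have "\<dots> \<longleftrightarrow> (\<exists>k\<ge>1. \<exists>vs. spanning_path T vs \<and> length vs = 3 * k + 2)"
  proof -
    \<comment> \<open>For \<open>k = 0\<close> there would be only two vertices.\<close>
    have "k \<ge> 1" if "spanning_path T vs" "length vs = 3 * k + 2" for k vs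
      using that assms(2) distinct_card[of vs] by (cases k) (auto simp: spanning_path_def)
    then show ?thesis by blast
  qed
  finally show ?thesis by (simp add: graph_iso_path_graph_iff[OF T(1)])
qed

end
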